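(* Let $R$ be a commutative ring and let $(\Sigma,w)$ be an $R$-balanced fan of dimension $d$. Then (for every $p\in\{0,\dots,d\}$) the cap product map $\frown[\Sigma,w]:H^0(\Sigma,F_R^p)\to H_d^{BM}(\Sigma,F_{d-p}^R)$ is injective.
   Context: **Fans.** Let $N\cong\mathbb{Z}^n$ be a lattice, $N_{\mathbb{R}}=N\otimes\mathbb{R}$. A rational polyhedral cone is a strictly convex cone generated by finitely many vectors of $N$; for a cone $\sigma$, $L_{\mathbb{Z}}(\sigma)=N\cap\mathrm{span}(\sigma)$ and $\dim\sigma=\mathrm{rank}\,L_{\mathbb{Z}}(\sigma)$. A (rational polyhedral) fan $\Sigma$ is a finite nonempty collection of such cones, closed under taking faces, any two meeting in a common face; fans are assumed pure dimensional (all maximal cones have the same dimension $d=\dim\Sigma$). Cones are also called faces. $\Sigma^i$ is the set of $i$-dimensional cones, $\tau\preceq\sigma$ means $\tau$ is a face of $\sigma$, and $v=\{0\}\in\Sigma$ is the vertex, the only compact cone. Fix an orientation of each cone; for $\tau\prec\sigma$ with $\dim\tau=\dim\sigma-1$ let $\mathcal{O}(\tau,\sigma)=\pm1$ be the relative orientation sign. **Tropical (co)homology.** $F_p^{\mathbb{Z}}(\sigma)=\sum_{\gamma\succeq\sigma}\bigwedge^pL_{\mathbb{Z}}(\gamma)\subseteq\bigwedge^pN$ (with $F_0^{\mathbb{Z}}(\sigma)=\mathbb{Z}$), $F_p^R(\sigma)=F_p^{\mathbb{Z}}(\sigma)\otimes_{\mathbb{Z}}R$, and for $\tau\preceq\sigma$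 the map $\iota_{\sigma,\tau}:F_p^R(\sigma)\to F_p^R(\tau)$ is induced by inclusion. $F^p_R(\sigma)=\mathrm{Hom}_R(F_p^R(\sigma),R)$ with $\rho_{\tau,\sigma}:F_R^p(\tau)\to F_R^p(\sigma)$ dual to $\iota_{\sigma,\tau}$. $C_q^{BM}(\Sigma,F_p^R)=\bigoplus_{\sigma\in\Sigma^q}F_p^R(\sigma)$, with boundary having components $\mathcal{O}(\tau,\sigma)\iota_{\sigma,\tau}$; its homology is $H_q^{BM}(\Sigma,F_p^R)$. $C^q(\Sigma,F_R^p)=\bigoplus F_R^p(\sigma)$ over compact $\sigma\in\Sigma^q$, with coboundary having components $\mathcal{O}(\tau,\sigma)\rho_{\tau,\sigma}$; its cohomology is $H^q(\Sigma,F_R^p)$ (so $C^0=F_R^p(v)$ and $C^q=0$ for $q>0$). **Balancing.** For $\alpha\in\Sigma^d$, $\Lambda_\alpha\in F_d^R(\alpha)=\bigwedge^dL_{\mathbb{Z}}(\alpha)\otimes R\cong R$ is the image of the generator of $\bigwedge^dL_{\mathbb{Z}}(\alpha)$ compatible with the orientation of $\alpha$. An $R$-weight function is $w:\Sigma^d\to R$ with no $w(\alpha)$ a zero-divisor. $(\Sigma,w)$ is $R$-balanced if the fundamental chain $\mathrm{Ch}(\Sigma,w)=(w(\alpha)\Lambda_\alpha)_\alpha\in C_d^{BM}(\Sigma,F_d^R)$ is a cycle; its class is the fundamental class $[\Sigma,w]\in H_d^{BM}(\Sigma,F_d^R)$. **Cap product.** For $y=y_1\wedge\dots\wedge y_m$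 in $\bigwedge^mM$ ($M$ free of finite rank) and $x=x_1\wedge\dots\wedge x_p\in\bigwedge^pM^*$, $p\le m$, the contraction is $x\lrcorner y=(-1)^{p(p-1)/2}\sum_a\mathrm{sign}(a)\left(\prod_{i=1}^px_i(y_{a(i)})\right)y_{a(p+1)}\wedge\dots\wedge y_{a(m)}\in\bigwedge^{m-p}M$, summing over permutations $a\in S_m$ increasing on $1,\dots,p$ and on $p+1,\dots,m$. The cap product $\frown[\Sigma,w]:H^q(\Sigma,F_R^p)\to H_{d-q}^{BM}(\Sigma,F_{d-p}^R)$ is induced by $(u_\gamma)_{\gamma\in\Sigma^q}\mapsto\left(\sum_{\alpha\in\Sigma^d,\ \gamma,\tau\preceq\alpha}w(\alpha)\,\iota_{\alpha,\tau}(\rho_{\gamma,\alpha}(u_\gamma)\lrcorner\Lambda_\alpha)\right)_{\tau\in\Sigma^{d-q}}$; for $q=0$ it is $u\mapsto(\rho_{v,\alpha}(u)\lrcorner w(\alpha)\Lambda_\alpha)_{\alpha\in\Sigma^d}$.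
   Formalization: The contraction is taken with x(y_{a(1)}∧…∧y_{a(p)}) (the determinant) in place of the printed product of the x_i(y_{a(i)}), which is not alternating in x_1,…,x_p and so is ill-defined on exterior powers for p≥2. *)

theory Defs
  imports
    "HOL-Analysis.Polytope"
    "HOL-Combinatorics.Permutations"
    "HOL-Algebra.Module"
    "HOL-Algebra.Generated_Groups"
    "HOL-Algebra.Product_Groups"
    "HOL-Algebra.Free_Abelian_Groups"
begin

section \<open>Lattices, cones and fans\<close>

text \<open>
  A lattice of rank \<open>n\<close> is the integral span of \<open>n\<close> linearly independent vectors of an ambient
  Euclidean space; \<open>N\<^sub>\<real>\<close> is then the real span of \<open>N\<close>, which need not be the whole ambient space.
\<close>

definition int_span :: "'v::real_vector set \<Rightarrow> 'v set" where
  "int_span B = {\<Sum>b\<in>B. real_of_int (c b) *\<^sub>R b | c. True}"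

definition lattice_basis :: "'v::real_vector set \<Rightarrow> 'v list \<Rightarrow> bool" where
  "lattice_basis L bs \<longleftrightarrow> distinct bs \<and> independent (set bs) \<and> L = int_span (set bs)"

definition is_lattice :: "'v::real_vector set \<Rightarrow> bool" where
  "is_lattice N \<longleftrightarrow> (\<exists>bs. lattice_basis N bs)"

definition rational_cone :: "'v::real_vector set \<Rightarrow> 'v set \<Rightarrow> bool" where
  "rational_cone N \<sigma> \<longleftrightarrow>
     (\<exists>S. finite S \<and> S \<subseteq> N \<and> \<sigma> = convex_cone hull S) \<and> \<sigma> \<inter> uminus ` \<sigma> = {0}"

definition cone_lattice :: "'v::real_vector set \<Rightarrow> 'v set \<Rightarrow> 'v set" where
  "cone_lattice N \<sigma> = N \<inter> span \<sigma>"

text \<open>The rank of a lattice is the dimension of its real span, which is what \<^const>\<open>dim\<close> computes.\<close>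

definition cone_dim :: "'v::real_vector set \<Rightarrow> 'v set \<Rightarrow> nat" where
  "cone_dim N \<sigma> = dim (cone_lattice N \<sigma>)"

text \<open>
  The library's \<open>face_of\<close> admits the empty set as a face, which is not a face of a cone. On the
  (nonempty) cones of a fan, \<open>\<tau> face_of \<sigma>\<close> is the relation \<open>\<tau> \<preceq> \<sigma>\<close>.
\<close>

definition pure_fan :: "'v::real_vector set \<Rightarrow> nat \<Rightarrow> 'v set set \<Rightarrow> bool" where
  "pure_fan N d \<Sigma> \<longleftrightarrow>
     finite \<Sigma> \<and> \<Sigma> \<noteq> {} \<and>
     (\<forall>\<sigma>\<in>\<Sigma>. rational_cone N \<sigma>) \<and>
     (\<forall>\<sigma>\<in>\<Sigma>. \<forall>\<tau>. \<tau> face_of \<sigma> \<and> \<tau> \<noteq> {} \<longrightarrow> \<tau> \<in> \<Sigma>) \<and>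
     (\<forall>\<sigma>\<in>\<Sigma>. \<forall>\<sigma>'\<in>\<Sigma>. (\<sigma> \<inter> \<sigma>') face_of \<sigma> \<and> (\<sigma> \<inter> \<sigma>') face_of \<sigma>') \<and>
     (\<forall>\<sigma>\<in>\<Sigma>. (\<forall>\<sigma>'\<in>\<Sigma>. \<sigma> face_of \<sigma>' \<longrightarrow> \<sigma>' = \<sigma>) \<longrightarrow> cone_dim N \<sigma> = d)"

text \<open>Degrees are integers, so that the groups of (co)chains of negative degree exist and vanish.\<close>

definition cones :: "'v::real_vector set \<Rightarrow> 'v set set \<Rightarrow> int \<Rightarrow> 'v set set" where
  "cones N \<Sigma> q = {\<sigma>\<in>\<Sigma>. int (cone_dim N \<sigma>) = q}"

definition compact_cones :: "'v::real_normed_vector set \<Rightarrow> 'v set set \<Rightarrow> int \<Rightarrow> 'v set set" where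
  "compact_cones N \<Sigma> q = {\<sigma>\<in>cones N \<Sigma> q. compact \<sigma>}"

text \<open>
  An orientation of \<open>\<sigma>\<close> is given by an ordered lattice basis of \<^term>\<open>cone_lattice N \<sigma>\<close>; the only
  basis for the vertex is \<open>[]\<close>, so the vertex carries the standard orientation.
\<close>

definition fan_orientation :: "'v::real_vector set \<Rightarrow> 'v set set \<Rightarrow> ('v set \<Rightarrow> 'v list) \<Rightarrow> bool" where
  "fan_orientation N \<Sigma> ori \<longleftrightarrow> (\<forall>\<sigma>\<in>\<Sigma>. lattice_basis (cone_lattice N \<sigma>) (ori \<sigma>))"


section \<open>Maps between quotients of groups\<close>

text \<open>
  The map on cosets induced by \<open>f\<close>, with values in cosets of \<open>B\<close> in \<open>G\<close>. If \<open>f\<close> is compatible with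
  the two quotients, all the cosets in the union agree.
\<close>

definition induced_map :: "('b, 'm) monoid_scheme \<Rightarrow> 'b set \<Rightarrow> ('a \<Rightarrow> 'b) \<Rightarrow> 'a set \<Rightarrow> 'b set" where
  "induced_map G B f X = (\<Union>x\<in>X. B #>\<^bsub>G\<^esub> f x)"


section \<open>Exterior powers of a lattice\<close>

definition tuples :: "'v set \<Rightarrow> nat \<Rightarrow> 'v list set" where
  "tuples N p = {xs. set xs \<subseteq> N \<and> length xs = p}"

definition ext_rels :: "'v::ab_group_add set \<Rightarrow> nat \<Rightarrow> ('v list \<Rightarrow>\<^sub>0 int) set" where
  "ext_rels N p = generate (free_Abelian_group (tuples N p))
     ({frag_of (xs[i := x + y]) - frag_of (xs[i := x]) - frag_of (xs[i := y]) | xs i x y.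
         xs \<in> tuples N p \<and> i < p \<and> x \<in> N \<and> y \<in> N} \<union>
      {frag_of xs | xs. xs \<in> tuples N p \<and> \<not> distinct xs})"

text \<open>\<open>\<And>\<^sup>p N\<close> over the integers; the group is written multiplicatively, as all quotients \<open>Mod\<close> are.\<close>

definition ext_power :: "'v::ab_group_add set \<Rightarrow> nat \<Rightarrow> ('v list \<Rightarrow>\<^sub>0 int) set monoid" where
  "ext_power N p = free_Abelian_group (tuples N p) Mod ext_rels N p"

definition wedge :: "'v::ab_group_add set \<Rightarrow> 'v list \<Rightarrow> ('v list \<Rightarrow>\<^sub>0 int) set" where
  "wedge N xs =
     ext_rels N (length xs) #>\<^bsub>free_Abelian_group (tuples N (length xs))\<^esub> frag_of xs"

text \<open>
  \<open>\<And>\<^sup>p L\<close> as a subgroup of \<open>\<And>\<^sup>p N\<close>, for a sublattice \<open>L = N \<inter> span \<gamma>\<close>. As \<open>L\<close> is a direct summand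
  of \<open>N\<close>, this subgroup is canonically isomorphic to the exterior power of \<open>L\<close> itself.
\<close>

definition ext_power_sub :: "'v::ab_group_add set \<Rightarrow> nat \<Rightarrow> 'v set \<Rightarrow> ('v list \<Rightarrow>\<^sub>0 int) set set" where
  "ext_power_sub N p L = generate (ext_power N p) (wedge N ` tuples L p)"


section \<open>Tensor products over the integers and dual modules\<close>

definition tensor_rels ::
    "('r, 'm) ring_scheme \<Rightarrow> ('g, 'n) monoid_scheme \<Rightarrow> ('g \<times> 'r \<Rightarrow>\<^sub>0 int) set" where
  "tensor_rels R G = generate (free_Abelian_group (carrier G \<times> carrier R))
     ({frag_of (g \<otimes>\<^bsub>G\<^esub> h, r) - frag_of (g, r) - frag_of (h, r) | g h r.
         g \<in> carrier G \<and> h \<in> carrier G \<and> r \<in> carrier R} \<union>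
      {frag_of (g, r \<oplus>\<^bsub>R\<^esub> s) - frag_of (g, r) - frag_of (g, s) | g r s.
         g \<in> carrier G \<and> r \<in> carrier R \<and> s \<in> carrier R})"

text \<open>
  The \<open>R\<close>-module \<open>G \<otimes>\<^sub>\<int> R\<close>. The fields \<open>mult\<close> and \<open>one\<close>, which modules inherit from the ring
  record, play no role in a module.
\<close>

definition tensor ::
    "('r, 'm) ring_scheme \<Rightarrow> ('g, 'n) monoid_scheme \<Rightarrow> ('r, ('g \<times> 'r \<Rightarrow>\<^sub>0 int) set) module" where
  "tensor R G =
     (let A = free_Abelian_group (carrier G \<times> carrier R); T = A Mod tensor_rels R G
      in \<lparr>carrier = carrier T, monoid.mult = undefined, monoid.one = undefined,
          ring.zero = \<one>\<^bsub>T\<^esub>, ring.add = (\<lambda>X Y. X \<otimes>\<^bsub>T\<^esub> Y),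
          module.smult = (\<lambda>r. induced_map A (tensor_rels R G)
                         (frag_extend (\<lambda>(g, s). frag_of (g, r \<otimes>\<^bsub>R\<^esub> s))))\<rparr>)"

definition pure_tensor ::
    "('r, 'm) ring_scheme \<Rightarrow> ('g, 'n) monoid_scheme \<Rightarrow> 'g \<Rightarrow> 'r \<Rightarrow> ('g \<times> 'r \<Rightarrow>\<^sub>0 int) set" where
  "pure_tensor R G g r =
     tensor_rels R G #>\<^bsub>free_Abelian_group (carrier G \<times> carrier R)\<^esub> frag_of (g, r)"

definition tensor_map ::
    "('r, 'm) ring_scheme \<Rightarrow> ('h, 'n) monoid_scheme \<Rightarrow> ('g \<Rightarrow> 'h) \<Rightarrow>
     ('g \<times> 'r \<Rightarrow>\<^sub>0 int) set \<Rightarrow> ('h \<times> 'r \<Rightarrow>\<^sub>0 int) set" where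
  "tensor_map R H f =
     induced_map (free_Abelian_group (carrier H \<times> carrier R)) (tensor_rels R H)
       (frag_extend (\<lambda>(g, r). frag_of (f g, r)))"

text \<open>
  The additive group of \<open>Hom\<^sub>R(M, R)\<close>. Homomorphisms are extensional functions, so that equality of
  functions is equality on the carrier of \<open>M\<close>.
\<close>

definition dual_module :: "('r, 'm) ring_scheme \<Rightarrow> ('r, 'a, 'n) module_scheme \<Rightarrow> ('a \<Rightarrow> 'r) monoid" where
  "dual_module R M =
     \<lparr>carrier = {f \<in> carrier M \<rightarrow>\<^sub>E carrier R.
        (\<forall>x\<in>carrier M. \<forall>y\<in>carrier M. f (x \<oplus>\<^bsub>M\<^esub> y) = f x \<oplus>\<^bsub>R\<^esub> f y) \<and>
        (\<forall>r\<in>carrier R. \<forall>x\<in>carrier M. f (r \<odot>\<^bsub>M\<^esub> x) = r \<otimes>\<^bsub>R\<^esub> f x)},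
      monoid.mult = (\<lambda>f g. \<lambda>x\<in>carrier M. f x \<oplus>\<^bsub>R\<^esub> g x),
      monoid.one = (\<lambda>x\<in>carrier M. \<zero>\<^bsub>R\<^esub>)\<rparr>"


section \<open>Tropical homology and cohomology\<close>

type_synonym ('v, 'r) coeff = "(('v list \<Rightarrow>\<^sub>0 int) set \<times> 'r \<Rightarrow>\<^sub>0 int) set"

definition FZ :: "'v::real_vector set \<Rightarrow> 'v set set \<Rightarrow> nat \<Rightarrow> 'v set \<Rightarrow> ('v list \<Rightarrow>\<^sub>0 int) set monoid" where
  "FZ N \<Sigma> p \<sigma> = (ext_power N p)\<lparr>carrier :=
     generate (ext_power N p)
       (\<Union>\<gamma>\<in>{\<gamma>\<in>\<Sigma>. \<sigma> face_of \<gamma>}. ext_power_sub N p (cone_lattice N \<gamma>))\<rparr>"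

definition FR :: "'v::real_vector set \<Rightarrow> ('r, 'm) ring_scheme \<Rightarrow> 'v set set \<Rightarrow> nat \<Rightarrow> 'v set \<Rightarrow>
    ('r, ('v, 'r) coeff) module" where
  "FR N R \<Sigma> p \<sigma> = tensor R (FZ N \<Sigma> p \<sigma>)"

definition F_dual :: "'v::real_vector set \<Rightarrow> ('r, 'm) ring_scheme \<Rightarrow> 'v set set \<Rightarrow> nat \<Rightarrow> 'v set \<Rightarrow>
    (('v, 'r) coeff \<Rightarrow> 'r) monoid" where
  "F_dual N R \<Sigma> p \<sigma> = dual_module R (FR N R \<Sigma> p \<sigma>)"

text \<open>
  \<open>F_incl \<dots> \<sigma> \<tau>\<close> is \<open>\<iota>\<^sub>\<sigma>\<^sub>,\<^sub>\<tau>\<close> and \<open>F_restr \<dots> \<tau> \<sigma>\<close> is \<open>\<rho>\<^sub>\<tau>\<^sub>,\<^sub>\<sigma>\<close>, for \<open>\<tau> \<preceq> \<sigma>\<close>. The formula for the former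
  does not involve \<open>\<sigma>\<close>, which only determines its domain.
\<close>

definition F_incl :: "'v::real_vector set \<Rightarrow> ('r, 'm) ring_scheme \<Rightarrow> 'v set set \<Rightarrow> nat \<Rightarrow> 'v set \<Rightarrow> 'v set \<Rightarrow>
    ('v, 'r) coeff \<Rightarrow> ('v, 'r) coeff" where
  "F_incl N R \<Sigma> p \<sigma> \<tau> = (\<lambda>x\<in>carrier (FR N R \<Sigma> p \<sigma>). tensor_map R (FZ N \<Sigma> p \<tau>) id x)"

definition F_restr :: "'v::real_vector set \<Rightarrow> ('r, 'm) ring_scheme \<Rightarrow> 'v set set \<Rightarrow> nat \<Rightarrow> 'v set \<Rightarrow> 'v set \<Rightarrow>
    (('v, 'r) coeff \<Rightarrow> 'r) \<Rightarrow> (('v, 'r) coeff \<Rightarrow> 'r)" where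
  "F_restr N R \<Sigma> p \<tau> \<sigma> f = (\<lambda>x\<in>carrier (FR N R \<Sigma> p \<sigma>). f (F_incl N R \<Sigma> p \<sigma> \<tau> x))"

text \<open>
  The relative orientation sign for a facet \<open>\<tau>\<close> of \<open>\<sigma>\<close>, with the convention that an outward
  pointing vector comes first: \<open>\<nu> \<in> N\<close> with \<open>-\<nu> \<in> \<sigma> - span \<tau>\<close>, followed by the basis orienting
  \<open>\<tau>\<close>, has the orientation of \<open>\<sigma>\<close> iff its wedge product is a positive multiple of that of the
  basis orienting \<open>\<sigma>\<close>.
\<close>

definition rel_sign :: "'v::real_vector set \<Rightarrow> ('v set \<Rightarrow> 'v list) \<Rightarrow> 'v set \<Rightarrow> 'v set \<Rightarrow> int" where
  "rel_sign N ori \<tau> \<sigma> =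
     (if \<exists>\<nu>\<in>N. \<exists>k>0. - \<nu> \<in> \<sigma> - span \<tau> \<and>
           wedge N (\<nu> # ori \<tau>) = wedge N (ori \<sigma>) [^]\<^bsub>ext_power N (length (ori \<sigma>))\<^esub> (k::nat)
      then 1 else -1)"

definition BM_chains :: "'v::real_vector set \<Rightarrow> ('r, 'm) ring_scheme \<Rightarrow> 'v set set \<Rightarrow> nat \<Rightarrow> int \<Rightarrow>
    ('v set \<Rightarrow> ('v, 'r) coeff) monoid" where
  "BM_chains N R \<Sigma> p q = sum_group (cones N \<Sigma> q) (\<lambda>\<sigma>. add_monoid (FR N R \<Sigma> p \<sigma>))"

definition BM_boundary :: "'v::real_vector set \<Rightarrow> ('r, 'm) ring_scheme \<Rightarrow> 'v set set \<Rightarrow> ('v set \<Rightarrow> 'v list) \<Rightarrow>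
    nat \<Rightarrow> int \<Rightarrow> ('v set \<Rightarrow> ('v, 'r) coeff) \<Rightarrow> ('v set \<Rightarrow> ('v, 'r) coeff)" where
  "BM_boundary N R \<Sigma> ori p q c =
     (\<lambda>\<tau>\<in>cones N \<Sigma> (q - 1).
        finsum (FR N R \<Sigma> p \<tau>)
          (\<lambda>\<sigma>. [rel_sign N ori \<tau> \<sigma>] \<cdot>\<^bsub>FR N R \<Sigma> p \<tau>\<^esub> F_incl N R \<Sigma> p \<sigma> \<tau> (c \<sigma>))
          {\<sigma>\<in>cones N \<Sigma> q. \<tau> face_of \<sigma>})"

definition BM_boundaries :: "'v::real_vector set \<Rightarrow> ('r, 'm) ring_scheme \<Rightarrow> 'v set set \<Rightarrow> ('v set \<Rightarrow> 'v list) \<Rightarrow>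
    nat \<Rightarrow> int \<Rightarrow> ('v set \<Rightarrow> ('v, 'r) coeff) set" where
  "BM_boundaries N R \<Sigma> ori p q =
     BM_boundary N R \<Sigma> ori p (q + 1) ` carrier (BM_chains N R \<Sigma> p (q + 1))"

definition BM_cycles :: "'v::real_vector set \<Rightarrow> ('r, 'm) ring_scheme \<Rightarrow> 'v set set \<Rightarrow> ('v set \<Rightarrow> 'v list) \<Rightarrow>
    nat \<Rightarrow> int \<Rightarrow> ('v set \<Rightarrow> ('v, 'r) coeff) monoid" where
  "BM_cycles N R \<Sigma> ori p q = (BM_chains N R \<Sigma> p q)\<lparr>carrier :=
     kernel (BM_chains N R \<Sigma> p q) (BM_chains N R \<Sigma> p (q - 1)) (BM_boundary N R \<Sigma> ori p q)\<rparr>"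

definition BM_homology :: "'v::real_vector set \<Rightarrow> ('r, 'm) ring_scheme \<Rightarrow> 'v set set \<Rightarrow> ('v set \<Rightarrow> 'v list) \<Rightarrow>
    nat \<Rightarrow> int \<Rightarrow> ('v set \<Rightarrow> ('v, 'r) coeff) set monoid" where
  "BM_homology N R \<Sigma> ori p q = BM_cycles N R \<Sigma> ori p q Mod BM_boundaries N R \<Sigma> ori p q"

definition cochains :: "'v::real_normed_vector set \<Rightarrow> ('r, 'm) ring_scheme \<Rightarrow> 'v set set \<Rightarrow> nat \<Rightarrow> int \<Rightarrow>
    ('v set \<Rightarrow> ('v, 'r) coeff \<Rightarrow> 'r) monoid" where
  "cochains N R \<Sigma> p q = sum_group (compact_cones N \<Sigma> q) (F_dual N R \<Sigma> p)"

definition coboundary :: "'v::real_normed_vector set \<Rightarrow> ('r, 'm) ring_scheme \<Rightarrow> 'v set set \<Rightarrow> ('v set \<Rightarrow> 'v list) \<Rightarrow>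
    nat \<Rightarrow> int \<Rightarrow> ('v set \<Rightarrow> ('v, 'r) coeff \<Rightarrow> 'r) \<Rightarrow> ('v set \<Rightarrow> ('v, 'r) coeff \<Rightarrow> 'r)" where
  "coboundary N R \<Sigma> ori p q u =
     (\<lambda>\<sigma>\<in>compact_cones N \<Sigma> (q + 1).
        finprod (F_dual N R \<Sigma> p \<sigma>)
          (\<lambda>\<tau>. F_restr N R \<Sigma> p \<tau> \<sigma> (u \<tau>) [^]\<^bsub>F_dual N R \<Sigma> p \<sigma>\<^esub> rel_sign N ori \<tau> \<sigma>)
          {\<tau>\<in>compact_cones N \<Sigma> q. \<tau> face_of \<sigma>})"

definition coboundaries :: "'v::real_normed_vector set \<Rightarrow> ('r, 'm) ring_scheme \<Rightarrow> 'v set set \<Rightarrow> ('v set \<Rightarrow> 'v list) \<Rightarrow>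
    nat \<Rightarrow> int \<Rightarrow> ('v set \<Rightarrow> ('v, 'r) coeff \<Rightarrow> 'r) set" where
  "coboundaries N R \<Sigma> ori p q =
     coboundary N R \<Sigma> ori p (q - 1) ` carrier (cochains N R \<Sigma> p (q - 1))"

definition cocycles :: "'v::real_normed_vector set \<Rightarrow> ('r, 'm) ring_scheme \<Rightarrow> 'v set set \<Rightarrow> ('v set \<Rightarrow> 'v list) \<Rightarrow>
    nat \<Rightarrow> int \<Rightarrow> ('v set \<Rightarrow> ('v, 'r) coeff \<Rightarrow> 'r) monoid" where
  "cocycles N R \<Sigma> ori p q = (cochains N R \<Sigma> p q)\<lparr>carrier :=
     kernel (cochains N R \<Sigma> p q) (cochains N R \<Sigma> p (q + 1)) (coboundary N R \<Sigma> ori p q)\<rparr>"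

definition cohomology :: "'v::real_normed_vector set \<Rightarrow> ('r, 'm) ring_scheme \<Rightarrow> 'v set set \<Rightarrow> ('v set \<Rightarrow> 'v list) \<Rightarrow>
    nat \<Rightarrow> int \<Rightarrow> ('v set \<Rightarrow> ('v, 'r) coeff \<Rightarrow> 'r) set monoid" where
  "cohomology N R \<Sigma> ori p q = cocycles N R \<Sigma> ori p q Mod coboundaries N R \<Sigma> ori p q"


section \<open>Balanced fans and the cap product\<close>

text \<open>Here \<open>0\<close> counts as a zero-divisor of a nonzero ring.\<close>

definition weight_function :: "'v::real_vector set \<Rightarrow> ('r, 'm) ring_scheme \<Rightarrow> 'v set set \<Rightarrow> nat \<Rightarrow>
    ('v set \<Rightarrow> 'r) \<Rightarrow> bool" where
  "weight_function N R \<Sigma> d w \<longleftrightarrow>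
     (\<forall>\<alpha>\<in>cones N \<Sigma> (int d). w \<alpha> \<in> carrier R \<and>
        (\<forall>r\<in>carrier R. w \<alpha> \<otimes>\<^bsub>R\<^esub> r = \<zero>\<^bsub>R\<^esub> \<longrightarrow> r = \<zero>\<^bsub>R\<^esub>))"

definition wedge_R :: "'v::real_vector set \<Rightarrow> ('r, 'm) ring_scheme \<Rightarrow> 'v set set \<Rightarrow> 'v set \<Rightarrow> 'v list \<Rightarrow>
    ('v, 'r) coeff" where
  "wedge_R N R \<Sigma> \<sigma> xs = pure_tensor R (FZ N \<Sigma> (length xs) \<sigma>) (wedge N xs) \<one>\<^bsub>R\<^esub>"

definition fundamental_chain :: "'v::real_vector set \<Rightarrow> ('r, 'm) ring_scheme \<Rightarrow> 'v set set \<Rightarrow> ('v set \<Rightarrow> 'v list) \<Rightarrow>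
    nat \<Rightarrow> ('v set \<Rightarrow> 'r) \<Rightarrow> ('v set \<Rightarrow> ('v, 'r) coeff)" where
  "fundamental_chain N R \<Sigma> ori d w =
     (\<lambda>\<alpha>\<in>cones N \<Sigma> (int d). w \<alpha> \<odot>\<^bsub>FR N R \<Sigma> d \<alpha>\<^esub> wedge_R N R \<Sigma> \<alpha> (ori \<alpha>))"

definition balanced :: "'v::real_vector set \<Rightarrow> ('r, 'm) ring_scheme \<Rightarrow> 'v set set \<Rightarrow> ('v set \<Rightarrow> 'v list) \<Rightarrow>
    nat \<Rightarrow> ('v set \<Rightarrow> 'r) \<Rightarrow> bool" where
  "balanced N R \<Sigma> ori d w \<longleftrightarrow>
     weight_function N R \<Sigma> d w \<and>
     fundamental_chain N R \<Sigma> ori d w \<in> carrier (BM_cycles N R \<Sigma> ori d (int d))"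

definition shuffle_perms :: "nat \<Rightarrow> nat \<Rightarrow> (nat \<Rightarrow> nat) set" where
  "shuffle_perms p m =
     {a. a permutes {..<m} \<and> strict_mono_on {..<p} a \<and> strict_mono_on {p..<m} a}"

text \<open>
  The contraction \<open>x \<lrcorner> (y\<^sub>1 \<and> \<dots> \<and> y\<^sub>m)\<close> at the cone \<open>\<alpha>\<close>, for \<open>x\<close> in \<open>F\<^sup>p(\<alpha>)\<close> and \<open>y\<^sub>i\<close> in the lattice
  of \<open>\<alpha>\<close>. Since \<open>x\<close> is a functional on \<open>p\<close>-vectors, its value on \<open>y\<^bsub>a(1)\<^esub> \<and> \<dots> \<and> y\<^bsub>a(p)\<^esub>\<close>
  takes the place of \<open>\<Prod>\<^sub>i x\<^sub>i(y\<^bsub>a(i)\<^esub>)\<close>, antisymmetrised over the first \<open>p\<close> indices. The result depends on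
  the list \<open>ys\<close> only through its wedge product. List positions are counted from \<open>0\<close>.
\<close>

definition contract :: "'v::real_vector set \<Rightarrow> ('r, 'm) ring_scheme \<Rightarrow> 'v set set \<Rightarrow> nat \<Rightarrow> 'v set \<Rightarrow>
    (('v, 'r) coeff \<Rightarrow> 'r) \<Rightarrow> 'v list \<Rightarrow> ('v, 'r) coeff" where
  "contract N R \<Sigma> p \<alpha> x ys =
     (let m = length ys; T = FR N R \<Sigma> (m - p) \<alpha>
      in [((-1::int) ^ (p * (p - 1) div 2))] \<cdot>\<^bsub>T\<^esub>
           finsum T
             (\<lambda>a. [sign a] \<cdot>\<^bsub>T\<^esub>
                (x (wedge_R N R \<Sigma> \<alpha> (map (\<lambda>i. ys ! a i) [0..<p])) \<odot>\<^bsub>T\<^esub>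
                 wedge_R N R \<Sigma> \<alpha> (map (\<lambda>i. ys ! a i) [p..<m])))
             (shuffle_perms p m))"

definition cap_chain :: "'v::real_vector set \<Rightarrow> ('r, 'm) ring_scheme \<Rightarrow> 'v set set \<Rightarrow> ('v set \<Rightarrow> 'v list) \<Rightarrow>
    nat \<Rightarrow> ('v set \<Rightarrow> 'r) \<Rightarrow> nat \<Rightarrow> ('v set \<Rightarrow> ('v, 'r) coeff \<Rightarrow> 'r) \<Rightarrow> ('v set \<Rightarrow> ('v, 'r) coeff)" where
  "cap_chain N R \<Sigma> ori d w p u =
     (\<lambda>\<alpha>\<in>cones N \<Sigma> (int d).
        w \<alpha> \<odot>\<^bsub>FR N R \<Sigma> (d - p) \<alpha>\<^esub> contract N R \<Sigma> p \<alpha> (F_restr N R \<Sigma> p {0} \<alpha> (u {0})) (ori \<alpha>))"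

text \<open>The map on (co)homology classes induced by \<^const>\<open>cap_chain\<close>, from \<open>H\<^sup>0(\<Sigma>, F\<^sup>p)\<close> to \<open>H\<^sub>d(\<Sigma>, F\<^bsub>d-p\<^esub>)\<close>.\<close>

definition cap_product :: "'v::real_vector set \<Rightarrow> ('r, 'm) ring_scheme \<Rightarrow> 'v set set \<Rightarrow> ('v set \<Rightarrow> 'v list) \<Rightarrow>
    nat \<Rightarrow> ('v set \<Rightarrow> 'r) \<Rightarrow> nat \<Rightarrow> ('v set \<Rightarrow> ('v, 'r) coeff \<Rightarrow> 'r) set \<Rightarrow> ('v set \<Rightarrow> ('v, 'r) coeff) set" where
  "cap_product N R \<Sigma> ori d w p =
     induced_map (BM_cycles N R \<Sigma> ori (d - p) (int d)) (BM_boundaries N R \<Sigma> ori (d - p) (int d))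
       (cap_chain N R \<Sigma> ori d w p)"

end

theory Submission
  imports Defs "HOL-Algebra.Elementary_Groups"
begin

text \<open>
  Let \<open>u\<close> be a functional on \<open>F\<^sub>p(v) \<otimes> R\<close>. The value of its cap product with the fundamental class at a
  top-dimensional cone \<open>\<alpha>\<close> is \<open>w(\<alpha>)\<close> times the contraction of \<open>u\<close> with the volume element
  \<open>y\<^sub>1 \<and> \<dots> \<and> y\<^sub>d\<close> of an oriented basis of the lattice \<open>L(\<alpha>)\<close>. That contraction is a combination of the
  wedge products of \<open>d - p\<close> basis vectors, which form a basis of \<open>\<And>\<^bsup>d-p\<^esup> L(\<alpha>) \<otimes> R\<close>, and its coefficients
  are, up to sign, the values of \<open>u\<close> on the wedge products of the complementary \<open>p\<close> basis vectors. As
  \<open>w(\<alpha>)\<close> is not a zero-divisor, the cap product determines these values, hence \<open>u\<close> on \<open>\<And>\<^sup>p L(\<alpha>)\<close>. Every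
  cone of the fan is a face of a top-dimensional one, so the groups \<open>\<And>\<^sup>p L(\<alpha>)\<close> generate \<open>F\<^sub>p(v)\<close> and \<open>u\<close>
  is determined. Finally, passing to classes loses nothing: all coboundaries in degree \<open>0\<close> and
  all boundaries in degree \<open>d\<close> are zero.

  Two facts of multilinear algebra carry this argument. One is that coefficients can be compared,
  that is, that the wedge products of basis vectors are independent over \<open>R\<close>. The functional that
  reads off one coefficient is a minor in the coordinates of the basis (\<open>dual_functional\<close>), whose scalars
  are then extended to \<open>R\<close> (\<open>extend_functional\<close>, \<open>coefficient_functional\<close>); applied to a contraction it
  yields \<open>contraction\<close> and \<open>contraction_cancel\<close>. The other is that these wedge products generate, which
  follows from multilinearity and antisymmetry (\<open>wedge_int_span_in_subgroup\<close>) and gives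
  \<open>F_dual_vertex_eqI\<close>.
\<close>

section \<open>Abelian groups given by generators and relations\<close>

lemma keys_sum_relator:
  assumes "a \<in> S" "b \<in> S" "c \<in> S"
  shows "Poly_Mapping.keys (frag_of a - frag_of b - frag_of c) \<subseteq> S"
proof -
  have "Poly_Mapping.keys (frag_of a - frag_of b - frag_of c) \<subseteq> {a, b, c}"
    using keys_diff[of "frag_of a - frag_of b" "frag_of c"] keys_diff[of "frag_of a" "frag_of b"]
    by (simp add: subset_iff) blast
  then show ?thesis by (rule order_trans) (simp add: assms)
qed

text \<open>
  Exterior powers and tensor products over the integers are both quotients of a free abelian group
  by relators of the form \<open>a - b - c\<close>, which express additivity; for exterior powers, some of the
  generators are killed as well. The quotients are treated together here.
\<close>

locale presentation =
  fixes S :: "'a set" and Q :: "('a \<Rightarrow>\<^sub>0 int) set"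
  assumes rels: "Q \<subseteq> carrier (free_Abelian_group S)"
begin

lemma rels_keys: "q \<in> Q \<Longrightarrow> Poly_Mapping.keys q \<subseteq> S"
  using rels by (metis carrier_free_Abelian_group_iff subsetD)

abbreviation "Fr \<equiv> free_Abelian_group S"
abbreviation "Rel \<equiv> generate Fr Q"
abbreviation "cls \<equiv> r_coset Fr Rel"

sublocale Fr: comm_group Fr
  by (rule abelian_free_Abelian_group)

lemma subgroup_Rel: "subgroup Rel Fr"
  by (rule Fr.generate_is_subgroup[OF rels])

lemma normal_Rel: "Rel \<lhd> Fr"
  using Fr.normal_iff_subgroup subgroup_Rel by blast

sublocale Qt: comm_group "Fr Mod Rel"
  by (rule Fr.abelian_FactGroup[OF subgroup_Rel])

lemma cls_hom: "cls \<in> hom Fr (Fr Mod Rel)"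
  by (rule normal.r_coset_hom_Mod[OF normal_Rel])

sublocale cls: group_hom Fr "Fr Mod Rel" cls
  by unfold_locales (rule cls_hom)

lemma cls_closed: "s \<in> S \<Longrightarrow> cls (frag_of s) \<in> carrier (Fr Mod Rel)"
  by (rule cls.hom_closed) simp

lemma cls_relator: "q \<in> Q \<Longrightarrow> cls q = \<one>\<^bsub>Fr Mod Rel\<^esub>"
  using Fr.coset_join2[OF _ subgroup_Rel] rels
  by (metis generate.incl one_FactGroup subsetD)

lemma cls_add:
  assumes "Poly_Mapping.keys x \<subseteq> S" "Poly_Mapping.keys y \<subseteq> S"
  shows "cls (x + y) = cls x \<otimes>\<^bsub>Fr Mod Rel\<^esub> cls y"
  using cls.hom_mult[of x y] assms by simp

lemma cls_diff:
  assumes "Poly_Mapping.keys x \<subseteq> S" "Poly_Mapping.keys y \<subseteq> S"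
  shows "cls (x - y) = cls x \<otimes>\<^bsub>Fr Mod Rel\<^esub> inv\<^bsub>Fr Mod Rel\<^esub> cls y"
proof -
  have "cls (x + - y) = cls x \<otimes>\<^bsub>Fr Mod Rel\<^esub> cls (- y)"
    using assms by (intro cls_add) (auto simp: keys_minus)
  also have "cls (- y) = inv\<^bsub>Fr Mod Rel\<^esub> cls y"
    using cls.hom_inv[of y] assms by simp
  finally show ?thesis by simp
qed

lemma cls_sum_relator:
  assumes "frag_of a - frag_of b - frag_of c \<in> Q" and S: "a \<in> S" "b \<in> S" "c \<in> S"
  shows "cls (frag_of a) = cls (frag_of b) \<otimes>\<^bsub>Fr Mod Rel\<^esub> cls (frag_of c)"
proof -
  have k: "Poly_Mapping.keys (frag_of b + frag_of c) \<subseteq> S"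
    using S keys_add[of "frag_of b" "frag_of c"] by auto
  have "cls (frag_of a) = cls ((frag_of a - frag_of b - frag_of c) + (frag_of b + frag_of c))"
    by simp
  also have "\<dots> = cls (frag_of a - frag_of b - frag_of c) \<otimes>\<^bsub>Fr Mod Rel\<^esub> cls (frag_of b + frag_of c)"
    using rels_keys[OF assms(1)] k by (intro cls_add)
  also have "\<dots> = cls (frag_of b + frag_of c)"
    unfolding cls_relator[OF assms(1)] by (rule Qt.l_one) (use k in auto)
  finally show ?thesis
    using S by (simp add: cls_add)
qed

text \<open>
  The induction principle for the quotient: a property that holds for the generators holds
  everywhere if the elements that have it form a subgroup.
\<close>

lemma generators_in_subgroup:
  assumes H: "subgroup H (Fr Mod Rel)" and gen: "\<And>s. s \<in> S \<Longrightarrow> cls (frag_of s) \<in> H"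
    and X: "X \<in> carrier (Fr Mod Rel)"
  shows "X \<in> H"
proof -
  interpret H: subgroup H "Fr Mod Rel" by (rule H)
  obtain t where t: "X = cls t" and k: "Poly_Mapping.keys t \<subseteq> S"
    using X by (auto simp: carrier_FactGroup)
  have "cls t \<in> H"
  proof (rule free_Abelian_group_induct[where P = "\<lambda>t. cls t \<in> H", OF k])
    show "cls 0 \<in> H"
      using H.one_closed cls.hom_one by simp
    show "cls (x - y) \<in> H" if "Poly_Mapping.keys x \<subseteq> S" "Poly_Mapping.keys y \<subseteq> S"
      "cls x \<in> H" "cls y \<in> H" for x y
      using that by (simp only: cls_diff) (intro H.m_closed H.m_inv_closed)
  qed (rule gen)
  with t show ?thesis by simp
qed

text \<open>
  The universal property. The hypothesis speaks of every extension \<open>h\<close> of \<open>f\<close> to the free group,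
  because an extension is known only through its values on the generators.
\<close>

lemma lift_hom:
  assumes G: "comm_group G" and f: "\<And>s. s \<in> S \<Longrightarrow> f s \<in> carrier G"
    and kill: "\<And>h q. h \<in> hom Fr G \<Longrightarrow> (\<And>s. s \<in> S \<Longrightarrow> h (frag_of s) = f s) \<Longrightarrow> q \<in> Q \<Longrightarrow> h q = \<one>\<^bsub>G\<^esub>"
  shows "\<exists>g \<in> hom (Fr Mod Rel) G. \<forall>s\<in>S. g (cls (frag_of s)) = f s"
proof -
  interpret G: comm_group G by (rule G)
  obtain h where h: "h \<in> hom Fr G" "\<And>s. s \<in> S \<Longrightarrow> h (frag_of s) = f s"
    using G.free_Abelian_group_universal[of f S] f by blast
  interpret h: group_hom Fr G h
    by unfold_locales (rule h(1))
  have "Rel \<subseteq> kernel Fr G h"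
    using kill[OF h]
    by (intro Fr.generate_subgroup_incl h.subgroup_kernel) (use rels_keys in \<open>auto simp: kernel_def\<close>)
  then obtain g where "g \<in> hom (Fr Mod Rel) G" "\<And>x. x \<in> carrier Fr \<Longrightarrow> g (cls x) = h x"
    using h.FactGroup_universal_kernel[OF normal_Rel] by blast
  with h(2) show ?thesis
    by (intro bexI[of _ g]) auto
qed

end

lemma hom_sum_relator:
  assumes G: "comm_group G" and h: "h \<in> hom (free_Abelian_group S) G"
    and S: "a \<in> S" "b \<in> S" "c \<in> S"
    and eq: "h (frag_of a) = h (frag_of b) \<otimes>\<^bsub>G\<^esub> h (frag_of c)"
  shows "h (frag_of a - frag_of b - frag_of c) = \<one>\<^bsub>G\<^esub>"
proof -
  interpret G: comm_group G by (rule G)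
  interpret h: group_hom "free_Abelian_group S" G h
    by (intro group_hom.intro group_hom_axioms.intro group_free_Abelian_group G.is_group h)
  let ?q = "frag_of a - frag_of b - frag_of c"
  have kbc: "Poly_Mapping.keys (frag_of b + frag_of c) \<subseteq> S"
    using S keys_add[of "frag_of b" "frag_of c"] by auto
  have kq: "Poly_Mapping.keys ?q \<subseteq> S"
    by (rule keys_sum_relator[OF S])
  have 1: "h (frag_of b + frag_of c) = h (frag_of a)"
    using h.hom_mult[of "frag_of b" "frag_of c"] S eq by simp
  have "h (frag_of a) = h (?q + (frag_of b + frag_of c))" by simp
  also have "\<dots> = h ?q \<otimes>\<^bsub>G\<^esub> h (frag_of a)"
    using h.hom_mult[of ?q "frag_of b + frag_of c"] kq kbc 1
    by (simp only: carrier_free_Abelian_group_iff mult_free_Abelian_group)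
  finally have "h ?q \<otimes>\<^bsub>G\<^esub> h (frag_of a) = h (frag_of a)" by simp
  moreover have "h ?q \<in> carrier G" "h (frag_of a) \<in> carrier G"
    using h.hom_closed[of ?q] h.hom_closed[of "frag_of a"] kq S by simp_all
  ultimately show ?thesis
    using G.r_cancel_one[of "h (frag_of a)" "h ?q"] by simp
qed

text \<open>
  A map on cosets that is defined as a union over representatives takes the expected value, provided
  that the map on representatives respects the relators.
\<close>

lemma induced_map_cls:
  assumes "presentation S Q" "presentation S' Q'"
    and h: "h \<in> hom (free_Abelian_group S) (free_Abelian_group S')"
    and hQ: "h ` Q \<subseteq> generate (free_Abelian_group S') Q'"
    and x: "Poly_Mapping.keys x \<subseteq> S"
  shows "induced_map (free_Abelian_group S') (generate (free_Abelian_group S') Q') h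
           (generate (free_Abelian_group S) Q #>\<^bsub>free_Abelian_group S\<^esub> x)
         = generate (free_Abelian_group S') Q' #>\<^bsub>free_Abelian_group S'\<^esub> h x"
proof -
  interpret P: presentation S Q by fact
  interpret P': presentation S' Q' by fact
  interpret h: group_hom P.Fr P'.Fr h
    by unfold_locales (rule h)
  have hRel: "h ` P.Rel \<subseteq> P'.Rel"
    using P'.Fr.generate_subgroup_incl[OF hQ P'.subgroup_Rel]
    by (simp only: h.generate_img[OF P.rels])
  have eq: "P'.cls (h y) = P'.cls (h x)" if y: "y \<in> P.cls x" for y
  proof -
    obtain k where k: "k \<in> P.Rel" "y = k + x"
      using y by (auto simp: r_coset_def)
    have kc: "k \<in> carrier P.Fr"
      by (rule subgroup.mem_carrier[OF P.subgroup_Rel k(1)])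
    have hk: "h k \<in> P'.Rel" "h k \<in> carrier P'.Fr" "h x \<in> carrier P'.Fr"
      using hRel k(1) h.hom_closed[OF kc] h.hom_closed[of x] x by (simp_all add: image_subset_iff)
    have "P'.cls (h y) = P'.cls (h k + h x)"
      using h.hom_mult[of k x] k kc x by simp
    also have "\<dots> = P'.cls (h k) \<otimes>\<^bsub>P'.Fr Mod P'.Rel\<^esub> P'.cls (h x)"
      using hk(2,3) by (intro P'.cls_add) simp_all
    also have "P'.cls (h k) = \<one>\<^bsub>P'.Fr Mod P'.Rel\<^esub>"
      using P'.Fr.coset_join2[OF hk(2) P'.subgroup_Rel hk(1)] by simp
    also have "\<one>\<^bsub>P'.Fr Mod P'.Rel\<^esub> \<otimes>\<^bsub>P'.Fr Mod P'.Rel\<^esub> P'.cls (h x) = P'.cls (h x)"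
      using hk by (intro P'.Qt.l_one P'.cls.hom_closed)
    finally show ?thesis .
  qed
  have "x \<in> P.cls x"
    using x P.Fr.rcos_self[OF _ P.subgroup_Rel] by simp
  then have ne: "P.cls x \<noteq> {}" by (rule ex_in_conv[THEN iffD1, OF exI])
  have "(\<Union>y\<in>P.cls x. P'.cls (h y)) = (\<Union>y\<in>P.cls x. P'.cls (h x))"
    by (rule SUP_cong[OF refl]) (rule eq)
  also have "\<dots> = P'.cls (h x)"
    by (simp only: UN_constant ne if_False)
  finally show ?thesis
    by (simp only: induced_map_def)
qed

section \<open>Exterior powers\<close>

definition ext_relators :: "'v::ab_group_add set \<Rightarrow> nat \<Rightarrow> ('v list \<Rightarrow>\<^sub>0 int) set" where
  "ext_relators N p =
     {frag_of (xs[i := x + y]) - frag_of (xs[i := x]) - frag_of (xs[i := y]) | xs i x y.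
         xs \<in> tuples N p \<and> i < p \<and> x \<in> N \<and> y \<in> N} \<union>
      {frag_of xs | xs. xs \<in> tuples N p \<and> \<not> distinct xs}"

lemma tuples_update: "xs \<in> tuples N p \<Longrightarrow> x \<in> N \<Longrightarrow> xs[i := x] \<in> tuples N p"
  using set_update_subset_insert[of xs i x] by (auto simp: tuples_def)

locale additive_subset =
  fixes N :: "'v::ab_group_add set"
  assumes add_closed: "x \<in> N \<Longrightarrow> y \<in> N \<Longrightarrow> x + y \<in> N"
begin

lemma presentation_ext: "presentation (tuples N p) (ext_relators N p)"
proof
  show "ext_relators N p \<subseteq> carrier (free_Abelian_group (tuples N p))"
  proof
    fix q
    assume "q \<in> ext_relators N p"
    then consider xs i x y where "xs \<in> tuples N p" "x \<in> N" "y \<in> N"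
        "q = frag_of (xs[i := x + y]) - frag_of (xs[i := x]) - frag_of (xs[i := y])"
      | xs where "xs \<in> tuples N p" "q = frag_of xs"
      unfolding ext_relators_def by blast
    then show "q \<in> carrier (free_Abelian_group (tuples N p))"
      by cases (simp_all add: keys_sum_relator tuples_update add_closed)
  qed
qed

lemma ext_rels_eq: "ext_rels N p = generate (free_Abelian_group (tuples N p)) (ext_relators N p)"
  by (simp add: ext_rels_def ext_relators_def)

lemma comm_group_ext_power: "comm_group (ext_power N p)"
proof -
  interpret E: presentation "tuples N p" "ext_relators N p" by (rule presentation_ext)
  show ?thesis
    unfolding ext_power_def ext_rels_eq by (rule E.Qt.comm_group_axioms)
qed

lemma wedge_closed:
  assumes "xs \<in> tuples N p"
  shows "wedge N xs \<in> carrier (ext_power N p)"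
proof -
  interpret E: presentation "tuples N p" "ext_relators N p" by (rule presentation_ext)
  have "length xs = p" using assms by (simp add: tuples_def)
  with E.cls_closed[OF assms] show ?thesis
    by (simp add: wedge_def ext_power_def ext_rels_eq)
qed

lemma wedge_add:
  assumes "xs \<in> tuples N p" "i < p" "x \<in> N" "y \<in> N"
  shows "wedge N (xs[i := x + y]) = wedge N (xs[i := x]) \<otimes>\<^bsub>ext_power N p\<^esub> wedge N (xs[i := y])"
proof -
  interpret E: presentation "tuples N p" "ext_relators N p" by (rule presentation_ext)
  have len: "length xs = p" using assms by (simp add: tuples_def)
  have "frag_of (xs[i := x + y]) - frag_of (xs[i := x]) - frag_of (xs[i := y]) \<in> ext_relators N p"
    unfolding ext_relators_def using assms by blast
  from E.cls_sum_relator[OF this] show ?thesis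
    using assms by (simp add: wedge_def ext_power_def ext_rels_eq len tuples_update add_closed)
qed

lemma wedge_repeated:
  assumes "xs \<in> tuples N p" "\<not> distinct xs"
  shows "wedge N xs = \<one>\<^bsub>ext_power N p\<^esub>"
proof -
  interpret E: presentation "tuples N p" "ext_relators N p" by (rule presentation_ext)
  have len: "length xs = p" using assms by (simp add: tuples_def)
  have "frag_of xs \<in> ext_relators N p"
    unfolding ext_relators_def using assms by blast
  from E.cls_relator[OF this] show ?thesis
    by (simp add: wedge_def ext_power_def ext_rels_eq len)
qed

text \<open>The universal property: multilinear alternating maps factor through the exterior power.\<close>

lemma ext_power_lift:
  assumes G: "comm_group G" and f: "\<And>xs. xs \<in> tuples N p \<Longrightarrow> f xs \<in> carrier G"
    and add: "\<And>xs i x y. \<lbrakk>xs \<in> tuples N p; i < p; x \<in> N; y \<in> N\<rbrakk> \<Longrightarrow>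
      f (xs[i := x + y]) = f (xs[i := x]) \<otimes>\<^bsub>G\<^esub> f (xs[i := y])"
    and alt: "\<And>xs. xs \<in> tuples N p \<Longrightarrow> \<not> distinct xs \<Longrightarrow> f xs = \<one>\<^bsub>G\<^esub>"
  shows "\<exists>h\<in>hom (ext_power N p) G. \<forall>xs\<in>tuples N p. h (wedge N xs) = f xs"
proof -
  interpret E: presentation "tuples N p" "ext_relators N p" by (rule presentation_ext)
  have "h q = \<one>\<^bsub>G\<^esub>"
    if h: "h \<in> hom E.Fr G" "\<And>xs. xs \<in> tuples N p \<Longrightarrow> h (frag_of xs) = f xs"
      and q: "q \<in> ext_relators N p" for h q
  proof -
    from q consider (add) xs i x y where "xs \<in> tuples N p" "i < p" "x \<in> N" "y \<in> N"
        "q = frag_of (xs[i := x + y]) - frag_of (xs[i := x]) - frag_of (xs[i := y])"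
      | (alt) xs where "xs \<in> tuples N p" "\<not> distinct xs" "q = frag_of xs"
      unfolding ext_relators_def by blast
    then show ?thesis
    proof cases
      case add
      then show ?thesis
        using hom_sum_relator[OF G h(1)] assms(3)
        by (simp add: tuples_update add_closed h(2))
    next
      case alt
      then show ?thesis
        by (simp add: h(2) assms(4))
    qed
  qed
  then have "\<exists>g\<in>hom (E.Fr Mod E.Rel) G. \<forall>xs\<in>tuples N p. g (E.cls (frag_of xs)) = f xs"
    by (intro E.lift_hom G f) auto
  then show ?thesis
    by (simp add: wedge_def ext_power_def ext_rels_eq tuples_def cong: ball_cong)
qed

text \<open>
  Expanding \<open>\<dots> \<and> (x + y) \<and> \<dots> \<and> (x + y) \<and> \<dots> = 0\<close> shows that a transposition of two entries
  inverts a wedge product.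
\<close>

lemma wedge_transpose:
  assumes xs: "xs \<in> tuples N p" and ij: "i < p" "j < p" "i \<noteq> j"
  shows "wedge N (xs[i := xs ! j, j := xs ! i]) = inv\<^bsub>ext_power N p\<^esub> wedge N xs"
proof -
  interpret E: comm_group "ext_power N p" by (rule comm_group_ext_power)
  have len: "length xs = p" using xs by (simp add: tuples_def)
  define x y W where "x = xs ! i" and "y = xs ! j" and "W = (\<lambda>a b. wedge N (xs[i := a, j := b]))"
  have "x \<in> N" "y \<in> N"
    using xs ij by (auto simp: tuples_def x_def y_def)
  with add_closed have N: "x \<in> N" "y \<in> N" "x + y \<in> N" by blast+
  have t: "xs[i := a, j := b] \<in> tuples N p" if "a \<in> N" "b \<in> N" for a b
    using xs that by (intro tuples_update)
  have W: "W a b \<in> carrier (ext_power N p)" if "a \<in> N" "b \<in> N" for a b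
    unfolding W_def using t[OF that] by (rule wedge_closed)
  have W0: "W a a = \<one>\<^bsub>ext_power N p\<^esub>" if "a \<in> N" for a
  proof -
    have "xs[i := a, j := a] ! i = xs[i := a, j := a] ! j"
      using ij len by simp
    then have "\<not> distinct (xs[i := a, j := a])"
      using ij len nth_eq_iff_index_eq[of "xs[i := a, j := a]" i j] by auto
    with t[OF that that] show ?thesis
      unfolding W_def by (rule wedge_repeated)
  qed
  have W2: "W a (b + c) = W a b \<otimes>\<^bsub>ext_power N p\<^esub> W a c" if "a \<in> N" "b \<in> N" "c \<in> N" for a b c
    using wedge_add[of "xs[i := a]" p j b c] ij that tuples_update[OF xs] by (simp add: W_def)
  have W1: "W (a + b) c = W a c \<otimes>\<^bsub>ext_power N p\<^esub> W b c" if "a \<in> N" "b \<in> N" "c \<in> N" for a b c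
    using wedge_add[of "xs[j := c]" p i a b] ij that tuples_update[OF xs]
    by (simp add: W_def list_update_swap[OF ij(3)])
  have "\<one>\<^bsub>ext_power N p\<^esub> = W (x + y) (x + y)"
    using W0 N by simp
  also have "\<dots> = W x y \<otimes>\<^bsub>ext_power N p\<^esub> W y x"
    unfolding W1[OF N] W2[OF N(1) N(1,2)] W2[OF N(2) N(1,2)] W0[OF N(1)] W0[OF N(2)]
    using W N by simp
  finally have "W y x = inv\<^bsub>ext_power N p\<^esub> W x y"
    using W[OF N(1,2)] W[OF N(2,1)] by (metis E.inv_equality E.m_comm)
  moreover have "W x y = wedge N xs"
    by (simp add: W_def x_def y_def)
  ultimately show ?thesis
    by (simp add: W_def x_def y_def)
qed

end

section \<open>Minors as functionals on exterior powers\<close>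

text \<open>
  The determinant of the square matrix with entries \<open>f k (xs ! i)\<close>. Its values are real because the
  coordinates that it is applied to are defined on the whole ambient space, where they are integral
  only on a sublattice.
\<close>

definition minor :: "(nat \<Rightarrow> 'v \<Rightarrow> real) \<Rightarrow> 'v list \<Rightarrow> real" where
  "minor f xs = (\<Sum>\<pi> | \<pi> permutes {..<length xs}. of_int (sign \<pi>) * (\<Prod>i<length xs. f (\<pi> i) (xs ! i)))"

lemma minor_add:
  assumes f: "\<And>k. f k (x + y) = f k x + f k y" and i: "i < length xs"
  shows "minor f (xs[i := x + y]) = minor f (xs[i := x]) + minor f (xs[i := y])"
proof -
  have *: "(\<Prod>j<length xs. f (\<pi> j) (xs[i := z] ! j))
      = f (\<pi> i) z * (\<Prod>j\<in>{..<length xs} - {i}. f (\<pi> j) (xs ! j))" for \<pi> z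
    using i by (subst prod.remove[of _ i]) auto
  show ?thesis
    unfolding minor_def length_list_update *
    by (simp add: f algebra_simps flip: sum.distrib)
qed

text \<open>Exchanging two equal arguments preserves each product and reverses the signs.\<close>

lemma minor_repeated:
  assumes "\<not> distinct xs"
  shows "minor f xs = 0"
proof -
  obtain i j where ij: "i < length xs" "j < length xs" "i \<noteq> j" "xs ! i = xs ! j"
    using assms by (auto simp: distinct_conv_nth)
  let ?t = "Transposition.transpose i j" and ?S = "{..<length xs}"
  have t: "?t permutes ?S"
    using ij by (intro permutes_swap_id) auto
  have "minor f xs = (\<Sum>\<pi> | \<pi> permutes ?S. of_int (sign (\<pi> \<circ> ?t)) * (\<Prod>k\<in>?S. f ((\<pi> \<circ> ?t) k) (xs ! k)))"
    unfolding minor_def by (rule sum_permutations_compose_right[OF t])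
  also have "\<dots> = (\<Sum>\<pi> | \<pi> permutes ?S. - (of_int (sign \<pi>) * (\<Prod>k\<in>?S. f (\<pi> k) (xs ! k))))"
  proof (rule sum.cong)
    fix \<pi> assume "\<pi> \<in> {\<pi>. \<pi> permutes ?S}"
    then have \<pi>: "permutation \<pi>"
      by (auto intro: permutes_imp_permutation[of ?S])
    have "sign (\<pi> \<circ> ?t) = - sign \<pi>"
      using ij by (simp add: sign_compose \<pi> permutation_swap_id sign_swap_id)
    moreover have "(\<Prod>k\<in>?S. f ((\<pi> \<circ> ?t) k) (xs ! k)) = (\<Prod>k\<in>?S. f (\<pi> k) (xs ! k))"
    proof (subst prod.permute[OF t], rule prod.cong[OF refl])
      show "((\<lambda>k. f ((\<pi> \<circ> ?t) k) (xs ! k)) \<circ> ?t) k = f (\<pi> k) (xs ! k)" for k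
        using ij by (simp add: Transposition.transpose_def)
    qed
    ultimately show "of_int (sign (\<pi> \<circ> ?t)) * (\<Prod>k\<in>?S. f ((\<pi> \<circ> ?t) k) (xs ! k))
        = - (of_int (sign \<pi>) * (\<Prod>k\<in>?S. f (\<pi> k) (xs ! k)))"
      by simp
  qed simp
  also have "\<dots> = - minor f xs"
    by (simp add: minor_def sum_negf)
  finally show ?thesis by simp
qed

lemma minor_Ints:
  assumes "\<And>k x. x \<in> set xs \<Longrightarrow> f k x \<in> \<int>"
  shows "minor f xs \<in> \<int>"
  unfolding minor_def using assms by (intro Ints_sum Ints_mult Ints_prod) auto

text \<open>
  The matrix is a submatrix of the identity matrix, with the rows \<open>b\<close> and the columns \<open>a\<close> in increasing
  order. A permutation contributes only if it matches the columns with the rows.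
\<close>

lemma minor_dual_basis:
  assumes dual: "\<And>i j. i < m \<Longrightarrow> j < m \<Longrightarrow> c j (ys ! i) = (if i = j then 1 else 0)"
    and b: "strict_mono_on {..<k} b" "b ` {..<k} \<subseteq> {..<m}"
    and a: "strict_mono_on {..<k} a" "a ` {..<k} \<subseteq> {..<m}"
  shows "minor (\<lambda>i. c (b i)) (map (\<lambda>i. ys ! a i) [0..<k]) = (if \<forall>i<k. a i = b i then 1 else 0)"
proof -
  have *: "(\<Prod>i<k. c (b (\<pi> i)) (map (\<lambda>i. ys ! a i) [0..<k] ! i)) = (if \<forall>i<k. a i = b (\<pi> i) then 1 else 0)"
    if \<pi>: "\<pi> permutes {..<k}" for \<pi>
  proof -
    have "(\<Prod>i<k. c (b (\<pi> i)) (map (\<lambda>i. ys ! a i) [0..<k] ! i)) = (\<Prod>i<k. if a i = b (\<pi> i) then 1 else 0)"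
    proof (rule prod.cong[OF refl])
      fix i assume i: "i \<in> {..<k}"
      then have "\<pi> i \<in> {..<k}" using permutes_in_image[OF \<pi>] by blast
      then show "c (b (\<pi> i)) (map (\<lambda>i. ys ! a i) [0..<k] ! i) = (if a i = b (\<pi> i) then 1 else 0)"
        using i a(2) b(2) by (simp add: dual image_subset_iff)
    qed
    also have "\<dots> = (if \<forall>i<k. a i = b (\<pi> i) then 1 else 0)"
      by (auto intro!: prod_zero)
    finally show ?thesis .
  qed
  \<comment> \<open>A permutation that matches two increasing sequences is itself increasing, hence trivial.\<close>
  have id: "\<pi> = id" if \<pi>: "\<pi> permutes {..<k}" and ab: "\<forall>i<k. a i = b (\<pi> i)" for \<pi>
  proof -
    have "strict_mono_on {..<k} \<pi>"
    proof (rule strict_mono_onI)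
      fix r s assume rs: "r \<in> {..<k}" "s \<in> {..<k}" "r < s"
      have \<pi>': "\<pi> r \<in> {..<k}" "\<pi> s \<in> {..<k}"
        using rs permutes_in_image[OF \<pi>] by blast+
      have "b (\<pi> r) < b (\<pi> s)"
        using strict_mono_onD[OF a(1)] rs ab by (metis lessThan_iff)
      then show "\<pi> r < \<pi> s"
        using strict_mono_on_less[OF b(1)] \<pi>' by blast
    qed
    note mono = this
    have "\<pi> i \<ge> i" if "i < k" for i
      using that
    proof (induction i)
      case (Suc i)
      have "\<pi> i < \<pi> (Suc i)"
        by (rule strict_mono_onD[OF mono]) (use Suc.prems in simp_all)
      moreover have "i \<le> \<pi> i"
        by (rule Suc.IH) (use Suc.prems in simp)
      ultimately show ?case by simp
    qed simp
    then show ?thesis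
      by (intro permutes_natset_ge[OF \<pi>]) simp
  qed
  have "minor (\<lambda>i. c (b i)) (map (\<lambda>i. ys ! a i) [0..<k])
      = (\<Sum>\<pi> | \<pi> permutes {..<k}. of_int (sign \<pi>) * (if \<forall>i<k. a i = b (\<pi> i) then 1 else 0))"
    unfolding minor_def by (rule sum.cong) (simp_all add: * del: nth_map)
  also have "\<dots> = (\<Sum>\<pi> | \<pi> permutes {..<k}. if \<pi> = id then (if \<forall>i<k. a i = b i then 1 else 0) else 0)"
    by (rule sum.cong) (auto dest: id)
  also have "\<dots> = (if \<forall>i<k. a i = b i then 1 else 0)"
    by (simp add: finite_permutations)
  finally show ?thesis .
qed

section \<open>Wedge products of basis vectors\<close>

lemma int_span_subset:
  assumes "finite B" and K0: "0 \<in> K" and Kadd: "\<And>x y. x \<in> K \<Longrightarrow> y \<in> K \<Longrightarrow> x + y \<in> K"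
    and Kminus: "\<And>x. x \<in> K \<Longrightarrow> - x \<in> K" and "B \<subseteq> K"
  shows "int_span B \<subseteq> K"
proof -
  have scale: "real_of_int c *\<^sub>R b \<in> K" if b: "b \<in> K" for b c
  proof (induction c rule: int_induct[where k = 0])
    case (step1 i)
    have "real_of_int (i + 1) *\<^sub>R b = real_of_int i *\<^sub>R b + b"
      by (simp add: scaleR_left_distrib)
    then show ?case using Kadd step1 b by simp
  next
    case (step2 i)
    have "real_of_int (i - 1) *\<^sub>R b = real_of_int i *\<^sub>R b + - b"
      by (simp add: scaleR_left_diff_distrib)
    then show ?case using Kadd[OF step2(2) Kminus[OF b]] by (simp only:)
  qed (simp add: K0)
  have "(\<Sum>b\<in>B'. real_of_int (c b) *\<^sub>R b) \<in> K" if "B' \<subseteq> B" for B' c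
    using finite_subset[OF that assms(1)] that
    by (induction B') (use K0 Kadd scale assms(5) in auto)
  then show ?thesis by (auto simp: int_span_def)
qed

lemma int_span_base: "finite B \<Longrightarrow> b \<in> B \<Longrightarrow> b \<in> int_span B"
  by (auto simp: int_span_def sum.remove[of B b] intro!: exI[of _ "\<lambda>x. if x = b then 1 else 0"] sum.neutral)

lemma int_span_group:
  shows "0 \<in> int_span B"
    and "x \<in> int_span B \<Longrightarrow> y \<in> int_span B \<Longrightarrow> x + y \<in> int_span B"
    and "x \<in> int_span B \<Longrightarrow> - x \<in> int_span B"
proof -
  show "0 \<in> int_span B"
    by (auto simp: int_span_def intro!: exI[of _ "\<lambda>_. 0"])
  show "x + y \<in> int_span B" if xy: "x \<in> int_span B" "y \<in> int_span B"
  proof -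
    obtain c c' where "x = (\<Sum>b\<in>B. real_of_int (c b) *\<^sub>R b)" "y = (\<Sum>b\<in>B. real_of_int (c' b) *\<^sub>R b)"
      using xy by (auto simp: int_span_def)
    then have "x + y = (\<Sum>b\<in>B. real_of_int (c b + c' b) *\<^sub>R b)"
      by (simp add: scaleR_left_distrib sum.distrib)
    then show ?thesis by (auto simp only: int_span_def)
  qed
  show "- x \<in> int_span B" if x: "x \<in> int_span B"
  proof -
    obtain c where "x = (\<Sum>b\<in>B. real_of_int (c b) *\<^sub>R b)"
      using x by (auto simp: int_span_def)
    then have "- x = (\<Sum>b\<in>B. real_of_int (- c b) *\<^sub>R b)"
      by (simp add: sum_negf)
    then show ?thesis by (auto simp only: int_span_def)
  qed
qed

text \<open>An increasing sequence is completed to a shuffle by the increasing sequence of the remaining indices.\<close>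

lemma shuffle_with_given_start:
  assumes js: "sorted js" "distinct js" "set js \<subseteq> {..<m}"
  shows "\<exists>a\<in>shuffle_perms (length js) m. \<forall>i<length js. a i = js ! i"
proof -
  define ks where "ks = sorted_list_of_set ({..<m} - set js)"
  define zs where "zs = js @ ks"
  have ks: "sorted ks" "distinct ks" "set ks = {..<m} - set js"
    by (simp_all add: ks_def)
  have zs: "distinct zs" "set zs = {..<m}"
    using js ks by (auto simp: zs_def)
  have len: "length zs = m"
    using distinct_card[OF zs(1)] zs(2) by simp
  define a where "a = (\<lambda>i. if i < m then zs ! i else i)"
  have "bij_betw a {..<m} {..<m}"
  proof -
    have "bij_betw ((!) zs) {..<m} {..<m}"
      by (rule bij_betw_nth) (use zs len in auto)
    then show ?thesis
      by (subst bij_betw_cong[where g = "(!) zs"]) (auto simp: a_def)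
  qed
  then have perm: "a permutes {..<m}"
    by (rule bij_imp_permutes) (simp add: a_def)
  have mono1: "strict_mono_on {..<length js} a"
  proof (rule strict_mono_onI)
    fix r s assume rs: "r \<in> {..<length js}" "s \<in> {..<length js}" "r < s"
    then have "js ! r < js ! s"
      using js sorted_wrt_nth_less[of "(<)" js r s] by (simp add: strict_sorted_iff)
    then show "a r < a s"
      using rs len by (simp add: a_def zs_def nth_append)
  qed
  have mono2: "strict_mono_on {length js..<m} a"
  proof (rule strict_mono_onI)
    fix r s assume rs: "r \<in> {length js..<m}" "s \<in> {length js..<m}" "r < s"
    then have "r - length js < s - length js" "s - length js < length ks"
      using len by (auto simp: zs_def)
    then have "ks ! (r - length js) < ks ! (s - length js)"
      using ks sorted_wrt_nth_less[of "(<)" ks] by (simp add: strict_sorted_iff)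
    then show "a r < a s"
      using rs by (simp add: a_def zs_def nth_append)
  qed
  have "a i = js ! i" if "i < length js" for i
    using that len by (simp add: a_def zs_def nth_append)
  then show ?thesis
    using perm mono1 mono2 unfolding shuffle_perms_def by blast
qed

locale additive_subgroup_of_vectors = additive_subset N for N :: "'v::real_vector set" +
  assumes zero_closed: "0 \<in> N" and minus_closed: "x \<in> N \<Longrightarrow> - x \<in> N"
begin

lemma wedge_slot_in_subgroup:
  assumes H: "subgroup H (ext_power N p)" and xs: "xs \<in> tuples N p" and i: "i < p"
    and B: "finite B" "B \<subseteq> N" "\<And>b. b \<in> B \<Longrightarrow> wedge N (xs[i := b]) \<in> H"
    and x: "x \<in> int_span B"
  shows "wedge N (xs[i := x]) \<in> H"
proof -
  interpret E: comm_group "ext_power N p" by (rule comm_group_ext_power)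
  interpret H: subgroup H "ext_power N p" by (rule H)
  let ?W = "\<lambda>x. wedge N (xs[i := x])"
  have W: "?W x \<in> carrier (ext_power N p)" if "x \<in> N" for x
    using tuples_update[OF xs that] by (rule wedge_closed)
  have add: "?W (x + y) = ?W x \<otimes>\<^bsub>ext_power N p\<^esub> ?W y" if "x \<in> N" "y \<in> N" for x y
    using xs i that by (rule wedge_add)
  have zero: "?W 0 = \<one>\<^bsub>ext_power N p\<^esub>"
    using add[OF zero_closed zero_closed] W[OF zero_closed] by simp
  have minus: "?W (- x) = inv\<^bsub>ext_power N p\<^esub> ?W x" if "x \<in> N" for x
  proof (rule E.inv_equality[symmetric])
    show "?W (- x) \<otimes>\<^bsub>ext_power N p\<^esub> ?W x = \<one>\<^bsub>ext_power N p\<^esub>"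
      using add[OF minus_closed[OF that] that] zero by simp
  qed (use W that minus_closed in auto)
  have "int_span B \<subseteq> {x \<in> N. ?W x \<in> H}"
  proof (rule int_span_subset)
    show "x + y \<in> {x \<in> N. ?W x \<in> H}" if "x \<in> {x \<in> N. ?W x \<in> H}" "y \<in> {x \<in> N. ?W x \<in> H}" for x y
      using that by (simp add: add add_closed)
    show "- x \<in> {x \<in> N. ?W x \<in> H}" if "x \<in> {x \<in> N. ?W x \<in> H}" for x
      using that by (simp add: minus minus_closed)
  qed (use B zero zero_closed in auto)
  with x show ?thesis by blast
qed

lemma wedge_permute_in_subgroup:
  assumes H: "subgroup H (ext_power N p)" and \<pi>: "\<pi> permutes {..<p}"
  shows "xs \<in> tuples N p \<Longrightarrow> wedge N (permute_list \<pi> xs) \<in> H \<Longrightarrow> wedge N xs \<in> H"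
  using \<pi> finite_lessThan
proof (induction \<pi> arbitrary: xs rule: permutes_induct)
  case (swap i j \<pi>)
  interpret E: comm_group "ext_power N p" by (rule comm_group_ext_power)
  interpret H: subgroup H "ext_power N p" by (rule H)
  have len: "length xs = p" using swap.prems by (simp add: tuples_def)
  let ?ys = "permute_list (Transposition.transpose i j) xs"
  have ys: "?ys = xs[i := xs ! j, j := xs ! i]"
    using swap.hyps len
    by (intro nth_equalityI) (auto simp: permute_list_def nth_list_update Transposition.transpose_def)
  have "?ys \<in> tuples N p"
    unfolding ys using swap.hyps swap.prems len
    by (intro tuples_update) (auto simp: tuples_def)
  moreover have "wedge N (permute_list \<pi> ?ys) \<in> H"
    using swap.prems(2) permute_list_compose[of \<pi> xs "Transposition.transpose i j"] swap.hyps len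
    by (simp only:)
  ultimately have "wedge N ?ys \<in> H"
    by (rule swap.IH)
  then have "inv\<^bsub>ext_power N p\<^esub> wedge N xs \<in> H"
    using wedge_transpose[OF swap.prems(1), of i j] swap.hyps by (simp add: ys)
  then have "inv\<^bsub>ext_power N p\<^esub> (inv\<^bsub>ext_power N p\<^esub> wedge N xs) \<in> H"
    by (rule H.m_inv_closed)
  then show ?case
    using wedge_closed[OF swap.prems(1)] by simp
qed simp

text \<open>
  A wedge product of basis vectors vanishes if a vector is repeated. Otherwise sorting the factors
  changes at most the sign, and sorted factors are the initial part of a shuffle.
\<close>

lemma wedge_basis_in_subgroup:
  assumes H: "subgroup H (ext_power N p)" and bs: "distinct bs" "set bs \<subseteq> N"
    and shuf: "\<And>a. a \<in> shuffle_perms p (length bs) \<Longrightarrow> wedge N (map (\<lambda>i. bs ! a i) [0..<p]) \<in> H"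
    and xs: "xs \<in> tuples (set bs) p"
  shows "wedge N xs \<in> H"
proof -
  have xsN: "xs \<in> tuples N p" and len: "length xs = p" and sub: "set xs \<subseteq> set bs"
    using xs bs by (auto simp: tuples_def)
  show ?thesis
  proof (cases "distinct xs")
    case False
    then show ?thesis
      using wedge_repeated[OF xsN] subgroup.one_closed[OF H] by simp
  next
    case True
    have "\<forall>x\<in>set xs. \<exists>j<length bs. bs ! j = x"
      using sub by (auto simp: in_set_conv_nth)
    then obtain f where f: "\<And>x. x \<in> set xs \<Longrightarrow> f x < length bs \<and> bs ! f x = x"
      by metis
    define js where "js = map f xs"
    have xs_js: "xs = map ((!) bs) js"
      using f by (simp add: js_def map_idI)
    have "inj_on f (set xs)"
      by (rule inj_onI) (metis f)
    with True have "distinct js" by (simp add: js_def distinct_map)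
    moreover have "set js \<subseteq> {..<length bs}" "length js = p"
      using f len by (auto simp: js_def)
    ultimately obtain a where a: "a \<in> shuffle_perms p (length bs)" "\<And>i. i < p \<Longrightarrow> a i = sort js ! i"
      using shuffle_with_given_start[of "sort js" "length bs"] by auto
    obtain \<pi> where \<pi>: "\<pi> permutes {..<length js}" "permute_list \<pi> js = sort js"
      using mset_eq_permutation[of "sort js" js] by auto
    have "permute_list \<pi> xs = map ((!) bs) (sort js)"
      unfolding xs_js using \<pi> by (simp add: permute_list_map)
    also have "\<dots> = map (\<lambda>i. bs ! a i) [0..<p]"
      using a(2) \<open>length js = p\<close> by (intro nth_equalityI) simp_all
    finally have "wedge N (permute_list \<pi> xs) \<in> H"
      using shuf[OF a(1)] by simp
    then show ?thesis
      using wedge_permute_in_subgroup[OF H _ xsN, of \<pi>] \<pi>(1) \<open>length js = p\<close> by simp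
  qed
qed

text \<open>
  The wedge products of increasing sequences of basis vectors span the exterior power of a lattice.
  The proof expands one factor after another by additivity; the induction is on the number of
  leading factors that are not yet known to be basis vectors.
\<close>

lemma wedge_int_span_in_subgroup:
  assumes H: "subgroup H (ext_power N p)" and bs: "distinct bs" "set bs \<subseteq> N"
    and shuf: "\<And>a. a \<in> shuffle_perms p (length bs) \<Longrightarrow> wedge N (map (\<lambda>i. bs ! a i) [0..<p]) \<in> H"
    and xs: "xs \<in> tuples (int_span (set bs)) p"
  shows "wedge N xs \<in> H"
proof -
  have L: "int_span (set bs) \<subseteq> N"
    by (rule int_span_subset) (use bs zero_closed add_closed minus_closed in auto)
  have "wedge N xs \<in> H"
    if "k \<le> p" "xs \<in> tuples (int_span (set bs)) p" "\<forall>i\<in>{k..<p}. xs ! i \<in> set bs" for k xs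
    using that
  proof (induction k arbitrary: xs)
    case 0
    then have "xs \<in> tuples (set bs) p"
      by (auto simp: tuples_def in_set_conv_nth subset_iff)
    then show ?case
      using wedge_basis_in_subgroup[OF H bs shuf] by blast
  next
    case (Suc k)
    have len: "length xs = p" using Suc.prems by (simp add: tuples_def)
    have "wedge N (xs[k := b]) \<in> H" if b: "b \<in> set bs" for b
    proof (rule Suc.IH)
      show "xs[k := b] \<in> tuples (int_span (set bs)) p"
        by (rule tuples_update[OF Suc.prems(2)]) (use b int_span_base in auto)
      show "\<forall>i\<in>{k..<p}. xs[k := b] ! i \<in> set bs"
        using Suc.prems b len by (auto simp: nth_list_update)
    qed (use Suc.prems in simp)
    note slot = this
    have k: "xs ! k \<in> int_span (set bs)" "k < p"
      using Suc.prems len by (auto simp: tuples_def subset_iff)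
    have "xs \<in> tuples N p"
      using Suc.prems(2) L by (auto simp: tuples_def)
    from wedge_slot_in_subgroup[OF H this k(2) finite_set bs(2) slot k(1)]
    have "wedge N (xs[k := xs ! k]) \<in> H" .
    then show ?case by simp
  qed
  from this[of p xs] xs show ?thesis by simp
qed

end

section \<open>Extension of scalars\<close>

definition tensor_relators ::
    "('r, 'm) ring_scheme \<Rightarrow> ('g, 'n) monoid_scheme \<Rightarrow> ('g \<times> 'r \<Rightarrow>\<^sub>0 int) set" where
  "tensor_relators R G =
     {frag_of (g \<otimes>\<^bsub>G\<^esub> h, r) - frag_of (g, r) - frag_of (h, r) | g h r.
         g \<in> carrier G \<and> h \<in> carrier G \<and> r \<in> carrier R} \<union>
      {frag_of (g, r \<oplus>\<^bsub>R\<^esub> s) - frag_of (g, r) - frag_of (g, s) | g r s.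
         g \<in> carrier G \<and> r \<in> carrier R \<and> s \<in> carrier R}"

lemma tensor_relators_cases:
  assumes "q \<in> tensor_relators R G"
  obtains g h r where "g \<in> carrier G" "h \<in> carrier G" "r \<in> carrier R"
      "q = frag_of (g \<otimes>\<^bsub>G\<^esub> h, r) - frag_of (g, r) - frag_of (h, r)"
    | g r s where "g \<in> carrier G" "r \<in> carrier R" "s \<in> carrier R"
      "q = frag_of (g, r \<oplus>\<^bsub>R\<^esub> s) - frag_of (g, r) - frag_of (g, s)"
  using assms unfolding tensor_relators_def by blast

lemma tensor_rels_eq:
  "tensor_rels R G = generate (free_Abelian_group (carrier G \<times> carrier R)) (tensor_relators R G)"
  by (simp add: tensor_rels_def tensor_relators_def)

lemma frag_extend_hom:
  assumes "\<And>s. s \<in> S \<Longrightarrow> Poly_Mapping.keys (f s) \<subseteq> S'"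
  shows "frag_extend f \<in> hom (free_Abelian_group S) (free_Abelian_group S')"
proof (rule homI)
  fix x assume "x \<in> carrier (free_Abelian_group S)"
  then have "\<Union> ((\<lambda>s. Poly_Mapping.keys (f s)) ` Poly_Mapping.keys x) \<subseteq> S'"
    using assms by (simp add: subset_iff) blast
  with keys_frag_extend show "frag_extend f x \<in> carrier (free_Abelian_group S')"
    by (metis carrier_free_Abelian_group_iff order_trans)
qed (simp add: frag_extend_add)

lemma subgroup_equalizer:
  assumes "group G" "group K" and h: "h \<in> hom G K" "h' \<in> hom G K"
  shows "subgroup {x \<in> carrier G. h x = h' x} G"
proof -
  interpret h: group_hom G K h using assms by (intro group_hom.intro group_hom_axioms.intro)
  interpret h': group_hom G K h' using assms by (intro group_hom.intro group_hom_axioms.intro)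
  show ?thesis
  proof (rule h.G.subgroupI)
    have "\<one>\<^bsub>G\<^esub> \<in> {x \<in> carrier G. h x = h' x}" by simp
    then show "{x \<in> carrier G. h x = h' x} \<noteq> {}" by blast
  qed auto
qed

locale extension_of_scalars = cring R + G: comm_group G
  for R :: "('r, 'm) ring_scheme" (structure) and G :: "('g, 'n) monoid_scheme"
begin

abbreviation "T \<equiv> tensor R G"

sublocale P: presentation "carrier G \<times> carrier R" "tensor_relators R G"
proof
  show "tensor_relators R G \<subseteq> carrier (free_Abelian_group (carrier G \<times> carrier R))"
  proof
    fix q assume "q \<in> tensor_relators R G"
    then show "q \<in> carrier (free_Abelian_group (carrier G \<times> carrier R))"
      by (cases rule: tensor_relators_cases) (simp_all add: keys_sum_relator)
  qed
qed

lemma tensor_simps: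
  "carrier T = carrier (P.Fr Mod P.Rel)"
  "X \<oplus>\<^bsub>T\<^esub> Y = X \<otimes>\<^bsub>P.Fr Mod P.Rel\<^esub> Y"
  "\<zero>\<^bsub>T\<^esub> = \<one>\<^bsub>P.Fr Mod P.Rel\<^esub>"
  "r \<odot>\<^bsub>T\<^esub> X = induced_map P.Fr P.Rel (frag_extend (\<lambda>(g, s). frag_of (g, r \<otimes> s))) X"
  by (simp_all add: tensor_def Let_def tensor_rels_eq)

lemma pure_tensor_eq: "pure_tensor R G g r = P.cls (frag_of (g, r))"
  by (simp add: pure_tensor_def tensor_rels_eq)

lemma abelian_group_tensor: "abelian_group T"
proof (rule comm_group_abelian_groupI, rule comm_groupI)
  show "\<exists>Y\<in>carrier (add_monoid T). Y \<otimes>\<^bsub>add_monoid T\<^esub> X = \<one>\<^bsub>add_monoid T\<^esub>"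
    if "X \<in> carrier (add_monoid T)" for X
    using that P.Qt.l_inv P.Qt.inv_closed by (metis tensor_simps(1-3) partial_object.select_convs(1) monoid.select_convs)
qed (simp_all add: tensor_simps(1-3) P.Qt.m_ac del: mult_FactGroup one_FactGroup)

sublocale T: abelian_group T
  by (rule abelian_group_tensor)

lemma pure_tensor_closed: "g \<in> carrier G \<Longrightarrow> r \<in> carrier R \<Longrightarrow> pure_tensor R G g r \<in> carrier T"
  unfolding tensor_simps pure_tensor_eq by (rule P.cls_closed) simp

lemma pure_tensor_mult:
  assumes "g \<in> carrier G" "h \<in> carrier G" "r \<in> carrier R"
  shows "pure_tensor R G (g \<otimes>\<^bsub>G\<^esub> h) r = pure_tensor R G g r \<oplus>\<^bsub>T\<^esub> pure_tensor R G h r"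
  unfolding tensor_simps pure_tensor_eq
  by (rule P.cls_sum_relator) (use assms in \<open>auto simp: tensor_relators_def\<close>)

lemma tensor_generated:
  assumes H: "subgroup H (add_monoid T)"
    and pure: "\<And>g r. g \<in> carrier G \<Longrightarrow> r \<in> carrier R \<Longrightarrow> pure_tensor R G g r \<in> H"
  shows "carrier T \<subseteq> H"
proof
  fix X assume X: "X \<in> carrier T"
  interpret H: subgroup H "add_monoid T" by (rule H)
  have "subgroup H (P.Fr Mod P.Rel)"
  proof (rule P.Qt.subgroupI)
    show sub: "H \<subseteq> carrier (P.Fr Mod P.Rel)"
      using H.subset by (simp add: tensor_simps)
    show "H \<noteq> {}" using H.one_closed by blast
    show "X \<otimes>\<^bsub>P.Fr Mod P.Rel\<^esub> Y \<in> H" if "X \<in> H" "Y \<in> H" for X Y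
      using H.m_closed[OF that] by (simp add: tensor_simps)
    show "inv\<^bsub>P.Fr Mod P.Rel\<^esub> X \<in> H" if X: "X \<in> H" for X
    proof -
      have "inv\<^bsub>add_monoid T\<^esub> X = inv\<^bsub>P.Fr Mod P.Rel\<^esub> X"
        by (simp add: m_inv_def tensor_simps)
      with H.m_inv_closed[OF X] show ?thesis by simp
    qed
  qed
  then show "X \<in> H"
    by (rule P.generators_in_subgroup) (use X pure in \<open>auto simp: pure_tensor_eq tensor_simps\<close>)
qed

context
  fixes r assumes r: "r \<in> carrier R"
begin

abbreviation (input) "sc \<equiv> frag_extend (\<lambda>(g, s). frag_of (g, r \<otimes> s))"

lemma scale_hom: "sc \<in> hom P.Fr P.Fr"
  by (rule frag_extend_hom) (use r in auto)

lemma smult_cls: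
  assumes "Poly_Mapping.keys x \<subseteq> carrier G \<times> carrier R"
  shows "r \<odot>\<^bsub>T\<^esub> P.cls x = P.cls (sc x)"
  unfolding tensor_simps
proof (rule induced_map_cls[OF P.presentation_axioms P.presentation_axioms scale_hom _ assms])
  show "sc ` tensor_relators R G \<subseteq> P.Rel"
  proof
    fix y assume "y \<in> sc ` tensor_relators R G"
    then obtain q where q: "q \<in> tensor_relators R G" and y: "y = sc q" by blast
    from q have "y \<in> tensor_relators R G"
    proof (cases rule: tensor_relators_cases)
      case (1 g h s)
      then show ?thesis
        using r by (auto simp: y frag_extend_diff tensor_relators_def)
    next
      case (2 g s t)
      then have "y = frag_of (g, r \<otimes> s \<oplus> r \<otimes> t) - frag_of (g, r \<otimes> s) - frag_of (g, r \<otimes> t)"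
        using r by (simp add: y frag_extend_diff r_distr)
      moreover have "r \<otimes> s \<in> carrier R" "r \<otimes> t \<in> carrier R" using 2 r by simp_all
      ultimately show ?thesis
        using 2(1) unfolding tensor_relators_def by blast
    qed
    then show "y \<in> P.Rel" by (rule generate.incl)
  qed
qed

lemma smult_hom: "(\<lambda>X. r \<odot>\<^bsub>T\<^esub> X) \<in> hom (add_monoid T) (add_monoid T)"
proof (rule homI; simp)
  interpret s: group_hom P.Fr P.Fr sc
    by unfold_locales (rule scale_hom)
  fix X assume "X \<in> carrier T"
  then obtain x where x: "X = P.cls x" "Poly_Mapping.keys x \<subseteq> carrier G \<times> carrier R"
    by (auto simp: tensor_simps carrier_FactGroup)
  then show "r \<odot>\<^bsub>T\<^esub> X \<in> carrier T"
    using P.cls.hom_closed[OF s.hom_closed[of x]] by (simp add: smult_cls tensor_simps(1))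
  fix Y assume "Y \<in> carrier T"
  then obtain y where y: "Y = P.cls y" "Poly_Mapping.keys y \<subseteq> carrier G \<times> carrier R"
    by (auto simp: tensor_simps carrier_FactGroup)
  have xy: "Poly_Mapping.keys (x + y) \<subseteq> carrier G \<times> carrier R"
    using P.Fr.m_closed[of x y] x y by simp
  have "X \<oplus>\<^bsub>T\<^esub> Y = P.cls (x + y)"
    using P.cls_add[OF x(2) y(2)] by (simp only: tensor_simps x y)
  then have "r \<odot>\<^bsub>T\<^esub> (X \<oplus>\<^bsub>T\<^esub> Y) = P.cls (sc x + sc y)"
    by (simp add: smult_cls xy frag_extend_add)
  also have "\<dots> = P.cls (sc x) \<otimes>\<^bsub>P.Fr Mod P.Rel\<^esub> P.cls (sc y)"
    using s.hom_closed[of x] s.hom_closed[of y] x(2) y(2) by (intro P.cls_add) simp_all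
  finally show "r \<odot>\<^bsub>T\<^esub> (X \<oplus>\<^bsub>T\<^esub> Y) = r \<odot>\<^bsub>T\<^esub> X \<oplus>\<^bsub>T\<^esub> r \<odot>\<^bsub>T\<^esub> Y"
    by (simp only: x y smult_cls tensor_simps(2))
qed

lemma smult_pure_tensor:
  assumes "g \<in> carrier G" "s \<in> carrier R"
  shows "r \<odot>\<^bsub>T\<^esub> pure_tensor R G g s = pure_tensor R G g (r \<otimes> s)"
  using assms by (simp add: pure_tensor_eq smult_cls)

end

lemma smult_closed: "r \<in> carrier R \<Longrightarrow> X \<in> carrier T \<Longrightarrow> r \<odot>\<^bsub>T\<^esub> X \<in> carrier T"
  using hom_in_carrier[OF smult_hom] by simp

text \<open>
  An integral functional \<open>\<phi>\<close> on \<open>G\<close> induces the \<open>R\<close>-linear functional \<open>g \<otimes> r \<mapsto> \<phi>(g) r\<close>. This is how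
  coefficients in a basis of \<open>G\<close> are read off after extension of scalars, over an arbitrary ring.
\<close>

lemma extend_functional:
  assumes \<phi>: "\<phi> \<in> hom G integer_group"
  shows "\<exists>\<Phi>\<in>hom (add_monoid T) (add_monoid R).
    (\<forall>g\<in>carrier G. \<forall>r\<in>carrier R. \<Phi> (pure_tensor R G g r) = [\<phi> g] \<cdot> r) \<and>
    (\<forall>r\<in>carrier R. \<forall>X\<in>carrier T. \<Phi> (r \<odot>\<^bsub>T\<^esub> X) = r \<otimes> \<Phi> X)"
proof -
  have cg: "comm_group (add_monoid R)" by (rule a_comm_group)
  have \<phi>_mult: "\<phi> (g \<otimes>\<^bsub>G\<^esub> h) = \<phi> g + \<phi> h" if "g \<in> carrier G" "h \<in> carrier G" for g h
    using hom_mult[OF \<phi> that] by (simp add: integer_group_def)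
  have "h q = \<zero>"
    if h: "h \<in> hom P.Fr (add_monoid R)"
      "\<And>s. s \<in> carrier G \<times> carrier R \<Longrightarrow> h (frag_of s) = [\<phi> (fst s)] \<cdot> snd s"
      and q: "q \<in> tensor_relators R G" for h q
    using q
  proof (cases rule: tensor_relators_cases)
    case (1 g h r)
    then show ?thesis
      using hom_sum_relator[OF cg h(1), of "(g \<otimes>\<^bsub>G\<^esub> h, r)" "(g, r)" "(h, r)"]
      by (simp add: h(2) \<phi>_mult add.int_pow_mult)
  next
    case (2 g r s)
    then show ?thesis
      using hom_sum_relator[OF cg h(1), of "(g, r \<oplus> s)" "(g, r)" "(g, s)"]
      by (simp add: h(2) add.int_pow_distrib)
  qed
  then have "\<exists>\<Phi>\<in>hom (P.Fr Mod P.Rel) (add_monoid R). \<forall>s\<in>carrier G \<times> carrier R.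
      \<Phi> (P.cls (frag_of s)) = [\<phi> (fst s)] \<cdot> snd s"
    by (intro P.lift_hom cg) (auto simp: add.int_pow_closed)
  then obtain \<Phi> where \<Phi>': "\<Phi> \<in> hom (P.Fr Mod P.Rel) (add_monoid R)"
    and pure: "\<And>g r. g \<in> carrier G \<Longrightarrow> r \<in> carrier R \<Longrightarrow> \<Phi> (pure_tensor R G g r) = [\<phi> g] \<cdot> r"
    by (force simp: pure_tensor_eq)
  have \<Phi>: "\<Phi> \<in> hom (add_monoid T) (add_monoid R)"
    using \<Phi>' by (simp add: hom_def tensor_simps)
  have scale: "\<Phi> (r \<odot>\<^bsub>T\<^esub> X) = r \<otimes> \<Phi> X" if r: "r \<in> carrier R" and X: "X \<in> carrier T" for r X
  proof -
    let ?H = "{X \<in> carrier (add_monoid T). \<Phi> (r \<odot>\<^bsub>T\<^esub> X) = r \<otimes> \<Phi> X}"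
    have "(\<lambda>X. \<Phi> (r \<odot>\<^bsub>T\<^esub> X)) \<in> hom (add_monoid T) (add_monoid R)"
      using hom_compose[OF smult_hom[OF r] \<Phi>] by (simp add: comp_def)
    moreover have "(\<lambda>X. r \<otimes> \<Phi> X) \<in> hom (add_monoid T) (add_monoid R)"
    proof (rule homI)
      have F: "\<Phi> X \<in> carrier R" if "X \<in> carrier T" for X
        using hom_in_carrier[OF \<Phi>, of X] that by simp
      show "r \<otimes> \<Phi> X \<in> carrier (add_monoid R)" if "X \<in> carrier (add_monoid T)" for X
        using F[of X] that r by simp
      show "r \<otimes> \<Phi> (X \<otimes>\<^bsub>add_monoid T\<^esub> Y) = (r \<otimes> \<Phi> X) \<otimes>\<^bsub>add_monoid R\<^esub> (r \<otimes> \<Phi> Y)"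
        if "X \<in> carrier (add_monoid T)" "Y \<in> carrier (add_monoid T)" for X Y
        using hom_mult[OF \<Phi> that] F[of X] F[of Y] that r by (simp add: r_distr)
    qed
    ultimately have "subgroup ?H (add_monoid T)"
      by (intro subgroup_equalizer[OF T.a_group a_group])
    then have "carrier T \<subseteq> ?H"
      by (rule tensor_generated)
         (use r in \<open>simp add: pure_tensor_closed smult_pure_tensor pure add_pow_rdistr_int\<close>)
    with X show ?thesis by blast
  qed
  show ?thesis
    using \<Phi> pure scale by blast
qed

end

text \<open>
  An inclusion of groups need not stay injective after extension of scalars: a nonzero pure tensor may
  become zero over the larger group. So the two tensor products are related only by this map.
\<close>

lemma tensor_map_id_pure_tensor:
  assumes "extension_of_scalars R G" "extension_of_scalars R G'"
    and sub: "carrier G \<subseteq> carrier G'" and mult: "monoid.mult G = monoid.mult G'"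
    and g: "g \<in> carrier G" "r \<in> carrier R"
  shows "tensor_map R G' id (pure_tensor R G g r) = pure_tensor R G' g r"
proof -
  interpret G: extension_of_scalars R G by fact
  interpret G': extension_of_scalars R G' by fact
  have id: "frag_extend (\<lambda>(g, r). frag_of (id g, r)) = (\<lambda>x. x)"
  proof -
    have eq: "(\<lambda>(g, r). frag_of (id g, r)) = frag_of" by (simp add: fun_eq_iff)
    show ?thesis
      by (rule ext, subst eq) (rule frag_expansion[symmetric])
  qed
  have "tensor_relators R G \<subseteq> tensor_relators R G'"
  proof
    fix q assume "q \<in> tensor_relators R G"
    then show "q \<in> tensor_relators R G'"
    proof (cases rule: tensor_relators_cases)
      case (1 g h r)
      with sub mult show ?thesis unfolding tensor_relators_def by auto
    next
      case (2 g r s)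
      with sub mult show ?thesis unfolding tensor_relators_def by auto
    qed
  qed
  then have "(\<lambda>x. x) ` tensor_relators R G \<subseteq> G'.P.Rel"
    by (auto intro: generate.incl)
  moreover have "(\<lambda>x. x) \<in> hom G.P.Fr G'.P.Fr"
  proof (rule homI)
    fix x assume "x \<in> carrier G.P.Fr"
    then have "Poly_Mapping.keys x \<subseteq> carrier G \<times> carrier R" by simp
    then show "x \<in> carrier G'.P.Fr"
      unfolding carrier_free_Abelian_group_iff using sub by (rule order_trans[OF _ Sigma_mono]) simp
  qed simp
  ultimately show ?thesis
    unfolding tensor_map_def id G.pure_tensor_eq G'.pure_tensor_eq tensor_rels_eq
    by (intro induced_map_cls[OF G.P.presentation_axioms G'.P.presentation_axioms]) (use g in simp_all)
qed

section \<open>Functionals dual to the wedge products of a lattice basis\<close>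

definition real_group :: "real monoid" where
  "real_group = \<lparr>carrier = UNIV, monoid.mult = (+), one = 0\<rparr>"

lemma real_group_simps [simp]:
  "carrier real_group = UNIV" "x \<otimes>\<^bsub>real_group\<^esub> y = x + y" "\<one>\<^bsub>real_group\<^esub> = 0"
  by (simp_all add: real_group_def)

lemma comm_group_real_group: "comm_group real_group"
proof (rule comm_groupI)
  show "\<exists>y\<in>carrier real_group. y \<otimes>\<^bsub>real_group\<^esub> x = \<one>\<^bsub>real_group\<^esub>" for x
    by (rule bexI[of _ "- x"]) simp_all
qed simp_all

lemma dual_coordinates:
  fixes ys :: "'v::euclidean_space list"
  assumes ys: "distinct ys" "independent (set ys)"
  obtains c :: "nat \<Rightarrow> 'v \<Rightarrow> real"
  where "\<And>j. linear (c j)"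
    and "\<And>i j. i < length ys \<Longrightarrow> j < length ys \<Longrightarrow> c j (ys ! i) = (if i = j then 1 else 0)"
    and "\<And>j x. x \<in> int_span (set ys) \<Longrightarrow> c j x \<in> \<int>"
proof -
  have "\<exists>g::'v \<Rightarrow> real. linear g \<and> (\<forall>y\<in>set ys. g y = (if j < length ys \<and> y = ys ! j then 1 else 0))" for j
    by (rule linear_independent_extend[OF ys(2)])
  then obtain c :: "nat \<Rightarrow> 'v \<Rightarrow> real" where lin: "\<And>j. linear (c j)"
    and c: "\<And>j y. y \<in> set ys \<Longrightarrow> c j y = (if j < length ys \<and> y = ys ! j then 1 else 0)"
    by metis
  show ?thesis
  proof
    show "c j (ys ! i) = (if i = j then 1 else 0)" if "i < length ys" "j < length ys" for i j
      using that ys(1) by (simp add: c nth_eq_iff_index_eq)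
    show "c j x \<in> \<int>" if x: "x \<in> int_span (set ys)" for j x
    proof -
      obtain k where "x = (\<Sum>b\<in>set ys. real_of_int (k b) *\<^sub>R b)"
        using x by (auto simp: int_span_def)
      then have "c j x = (\<Sum>b\<in>set ys. real_of_int (k b) * c j b)"
        using lin[of j] by (simp add: linear_sum linear_cmul)
      also have "\<dots> \<in> \<int>"
        by (intro Ints_sum Ints_mult) (auto simp: c)
      finally show ?thesis .
    qed
  qed (rule lin)
qed

text \<open>
  A minor in the coordinates of a basis \<open>ys\<close> of a sublattice \<open>L\<close> is defined on the exterior power of
  the whole lattice \<open>N\<close>, with real values. It is integral on the wedge products of vectors of \<open>L\<close>, so
  it restricts to an integral functional there, and no basis of \<open>N\<close> that extends \<open>ys\<close> has to be found.
\<close>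

lemma dual_functional:
  fixes N :: "'v::euclidean_space set" and ys :: "'v list" and b :: "nat \<Rightarrow> nat"
  assumes N: "additive_subgroup_of_vectors N"
    and ys: "distinct ys" "independent (set ys)"
    and L: "int_span (set ys) \<subseteq> N"
    and b: "strict_mono_on {..<k} b" "b ` {..<k} \<subseteq> {..<length ys}"
  shows "\<exists>\<phi>\<in>hom ((ext_power N k)\<lparr>carrier := ext_power_sub N k (int_span (set ys))\<rparr>) integer_group.
    \<forall>a. strict_mono_on {..<k} a \<longrightarrow> a ` {..<k} \<subseteq> {..<length ys} \<longrightarrow>
      \<phi> (wedge N (map (\<lambda>i. ys ! a i) [0..<k])) = (if \<forall>i<k. a i = b i then 1 else 0)"
proof -
  interpret additive_subgroup_of_vectors N by (rule N)
  interpret E: comm_group "ext_power N k" by (rule comm_group_ext_power)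
  interpret Re: comm_group real_group by (rule comm_group_real_group)
  let ?L = "int_span (set ys)"
  obtain c :: "nat \<Rightarrow> 'v \<Rightarrow> real" where lin: "\<And>j. linear (c j)"
    and dual: "\<And>i j. i < length ys \<Longrightarrow> j < length ys \<Longrightarrow> c j (ys ! i) = (if i = j then 1 else 0)"
    and int: "\<And>j x. x \<in> ?L \<Longrightarrow> c j x \<in> \<int>"
    using dual_coordinates[OF ys] by metis
  let ?f = "minor (\<lambda>i. c (b i))"
  have "\<exists>h\<in>hom (ext_power N k) real_group. \<forall>xs\<in>tuples N k. h (wedge N xs) = ?f xs"
  proof (rule ext_power_lift[OF comm_group_real_group])
    show "?f (xs[i := x + y]) = ?f (xs[i := x]) \<otimes>\<^bsub>real_group\<^esub> ?f (xs[i := y])"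
      if "xs \<in> tuples N k" "i < k" for xs i x y
      using that by (simp add: minor_add linear_add[OF lin] tuples_def)
    show "?f xs = \<one>\<^bsub>real_group\<^esub>" if "\<not> distinct xs" for xs
      using minor_repeated[OF that] by simp
  qed simp
  then obtain h where h: "h \<in> hom (ext_power N k) real_group"
    and h_wedge: "\<And>xs. xs \<in> tuples N k \<Longrightarrow> h (wedge N xs) = ?f xs"
    by blast
  interpret h: group_hom "ext_power N k" real_group h
    by (intro group_hom.intro group_hom_axioms.intro E.is_group Re.is_group h)
  have LN: "tuples ?L k \<subseteq> tuples N k"
    using L by (auto simp: tuples_def)
  have inv_real: "inv\<^bsub>real_group\<^esub> x = - x" for x
    by (rule Re.inv_equality) simp_all
  have "ext_power_sub N k ?L \<subseteq> {X \<in> carrier (ext_power N k). h X \<in> \<int>}"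
    unfolding ext_power_sub_def
  proof (rule E.generate_subgroup_incl)
    show "wedge N ` tuples ?L k \<subseteq> {X \<in> carrier (ext_power N k). h X \<in> \<int>}"
    proof clarify
      fix xs assume xs: "xs \<in> tuples ?L k"
      have "h (wedge N xs) \<in> \<int>"
        unfolding h_wedge[OF subsetD[OF LN xs]]
        by (rule minor_Ints) (use xs int in \<open>auto simp: tuples_def\<close>)
      then show "wedge N xs \<in> carrier (ext_power N k) \<and> h (wedge N xs) \<in> \<int>"
        using wedge_closed[OF subsetD[OF LN xs]] by blast
    qed
    show "subgroup {X \<in> carrier (ext_power N k). h X \<in> \<int>} (ext_power N k)"
    proof (rule E.subgroupI)
      have "\<one>\<^bsub>ext_power N k\<^esub> \<in> {X \<in> carrier (ext_power N k). h X \<in> \<int>}"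
        using h.hom_one by simp
      then show "{X \<in> carrier (ext_power N k). h X \<in> \<int>} \<noteq> {}" by blast
    qed (auto simp: inv_real)
  qed
  then have sub: "X \<in> carrier (ext_power N k)" "h X \<in> \<int>" if "X \<in> ext_power_sub N k ?L" for X
    using that by auto
  \<comment> \<open>On integral values the floor only changes the type.\<close>
  define \<phi> where "\<phi> X = \<lfloor>h X\<rfloor>" for X
  have "\<phi> \<in> hom ((ext_power N k)\<lparr>carrier := ext_power_sub N k ?L\<rparr>) integer_group"
  proof (rule homI)
    fix X Y
    assume "X \<in> carrier ((ext_power N k)\<lparr>carrier := ext_power_sub N k ?L\<rparr>)"
      and "Y \<in> carrier ((ext_power N k)\<lparr>carrier := ext_power_sub N k ?L\<rparr>)"
    then have X: "X \<in> ext_power_sub N k ?L" and Y: "Y \<in> ext_power_sub N k ?L" by simp_all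
    have "h (X \<otimes>\<^bsub>ext_power N k\<^esub> Y) = h X + h Y"
      using h.hom_mult[OF sub(1)[OF X] sub(1)[OF Y]] by simp
    moreover have "of_int \<lfloor>h X\<rfloor> = h X" "of_int \<lfloor>h Y\<rfloor> = h Y"
      using sub(2)[OF X] sub(2)[OF Y] by (simp_all add: of_int_floor_cancel)
    ultimately have "\<phi> (X \<otimes>\<^bsub>ext_power N k\<^esub> Y) = \<phi> X + \<phi> Y"
      unfolding \<phi>_def by linarith
    then show "\<phi> (X \<otimes>\<^bsub>(ext_power N k)\<lparr>carrier := ext_power_sub N k ?L\<rparr>\<^esub> Y) = \<phi> X \<otimes>\<^bsub>integer_group\<^esub> \<phi> Y"
      by simp
  qed simp
  moreover have "\<phi> (wedge N (map (\<lambda>i. ys ! a i) [0..<k])) = (if \<forall>i<k. a i = b i then 1 else 0)"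
    if a: "strict_mono_on {..<k} a" "a ` {..<k} \<subseteq> {..<length ys}" for a
  proof -
    have "ys ! a i \<in> ?L" if "i < k" for i
      using a(2) that by (intro int_span_base) (simp_all add: image_subset_iff)
    then have "map (\<lambda>i. ys ! a i) [0..<k] \<in> tuples ?L k"
      by (simp add: tuples_def image_subset_iff)
    from h_wedge[OF subsetD[OF LN this]]
    have "h (wedge N (map (\<lambda>i. ys ! a i) [0..<k])) = (if \<forall>i<k. a i = b i then 1 else 0)"
      by (simp only: minor_dual_basis[OF dual b a])
    then show ?thesis by (simp add: \<phi>_def)
  qed
  ultimately show ?thesis
    by (intro bexI[of _ \<phi>] allI impI)
qed

section \<open>Lattices and fans\<close>

lemma lattice_basis_simps:
  assumes "lattice_basis L bs"
  shows "distinct bs" "independent (set bs)" "L = int_span (set bs)"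
  using assms by (auto simp: lattice_basis_def)

lemma lattice_basis_length:
  fixes L :: "'v::euclidean_space set"
  assumes "lattice_basis L bs"
  shows "length bs = dim L"
proof -
  have "set bs \<subseteq> int_span (set bs)"
    by (auto intro: int_span_base)
  moreover have "int_span (set bs) \<subseteq> span (set bs)"
    by (rule int_span_subset) (auto intro: span_base span_add span_neg span_zero)
  ultimately have "dim L = dim (set bs)"
    using lattice_basis_simps(3)[OF assms] by (metis dim_subset dim_span order_antisym)
  also have "\<dots> = length bs"
    using lattice_basis_simps[OF assms] by (simp add: dim_eq_card_independent distinct_card)
  finally show ?thesis by simp
qed

lemma is_lattice_subgroup:
  assumes "is_lattice N"
  shows "additive_subgroup_of_vectors N"
proof -
  obtain bs where N: "N = int_span (set bs)"
    using assms by (auto simp: is_lattice_def lattice_basis_def)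
  show ?thesis
    unfolding N by unfold_locales (rule int_span_group; assumption?)+
qed

text \<open>
  If \<open>0\<close> is strictly between two points of a cone, then the line through them lies in the cone, which
  strict convexity excludes.
\<close>

lemma face_of_zero:
  assumes "rational_cone N \<sigma>"
  shows "{0} face_of \<sigma>"
proof -
  obtain S where \<sigma>: "\<sigma> = convex_cone hull S" and sc: "\<sigma> \<inter> uminus ` \<sigma> = {0}"
    using assms by (auto simp: rational_cone_def)
  have zero: "x = 0 \<and> y = 0"
    if xy: "x \<in> \<sigma>" "y \<in> \<sigma>" "0 \<in> open_segment x y" for x y
  proof -
    obtain u where u: "0 < u" "u < 1" "0 = (1 - u) *\<^sub>R x + u *\<^sub>R y" "x \<noteq> y"
      using xy(3) by (auto simp: in_segment)
    have "u *\<^sub>R y \<in> \<sigma>" "(1 - u) *\<^sub>R x \<in> \<sigma>"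
      using xy u \<sigma> by (auto intro!: convex_cone_hull_mul)
    moreover have "u *\<^sub>R y = - ((1 - u) *\<^sub>R x)"
      using u(3) by (simp add: eq_neg_iff_add_eq_0 add.commute)
    ultimately have "u *\<^sub>R y \<in> \<sigma> \<inter> uminus ` \<sigma>" by blast
    then have "u *\<^sub>R y = 0" using sc by blast
    then show ?thesis using u by auto
  qed
  show ?thesis
    unfolding face_of_def using sc zero by blast
qed

lemma rational_cone_dim_zero:
  fixes N :: "'v::euclidean_space set"
  assumes "rational_cone N \<sigma>" "cone_dim N \<sigma> = 0"
  shows "\<sigma> = {0}"
proof -
  obtain S where S: "S \<subseteq> N" "\<sigma> = convex_cone hull S" and sc: "\<sigma> \<inter> uminus ` \<sigma> = {0}"
    using assms by (auto simp: rational_cone_def)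
  have "S \<subseteq> cone_lattice N \<sigma>"
    using S hull_subset[of S convex_cone] by (auto simp: cone_lattice_def intro: span_base)
  then have "S \<subseteq> {0}"
    using assms(2) by (auto simp: cone_dim_def dim_eq_0)
  then have "\<sigma> \<subseteq> {0}"
    unfolding S(2) by (rule hull_minimal) (simp add: convex_cone_iff)
  then show ?thesis using sc by blast
qed

lemma cone_lattice_mono: "\<sigma> \<subseteq> \<gamma> \<Longrightarrow> cone_lattice N \<sigma> \<subseteq> cone_lattice N \<gamma>"
  unfolding cone_lattice_def using span_mono by blast

locale fan =
  fixes N :: "'v::euclidean_space set" and d :: nat and \<Sigma> :: "'v set set"
  assumes pure_fan: "pure_fan N d \<Sigma>" and lattice: "is_lattice N"
begin

sublocale additive_subgroup_of_vectors N
  by (rule is_lattice_subgroup[OF lattice])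

lemma rational: "\<sigma> \<in> \<Sigma> \<Longrightarrow> rational_cone N \<sigma>"
  using pure_fan by (simp add: pure_fan_def)

lemma faces: "\<sigma> \<in> \<Sigma> \<Longrightarrow> \<tau> face_of \<sigma> \<Longrightarrow> \<tau> \<noteq> {} \<Longrightarrow> \<tau> \<in> \<Sigma>"
  using pure_fan by (simp add: pure_fan_def)

lemma finite_fan: "finite \<Sigma>" and nonempty: "\<Sigma> \<noteq> {}"
  using pure_fan by (simp_all add: pure_fan_def)

lemma maximal_dim:
  "\<sigma> \<in> \<Sigma> \<Longrightarrow> (\<And>\<gamma>. \<gamma> \<in> \<Sigma> \<Longrightarrow> \<sigma> face_of \<gamma> \<Longrightarrow> \<gamma> = \<sigma>) \<Longrightarrow> cone_dim N \<sigma> = d"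
  using pure_fan by (simp add: pure_fan_def)

lemma vertex_in_fan: "{0} \<in> \<Sigma>"
  using nonempty rational face_of_zero faces by (metis ex_in_conv insert_not_empty)

lemma vertex_face: "\<sigma> \<in> \<Sigma> \<Longrightarrow> {0} face_of \<sigma>"
  using rational face_of_zero by blast

lemma convex_cone_in_fan: "\<sigma> \<in> \<Sigma> \<Longrightarrow> convex \<sigma>"
  using rational by (auto simp: rational_cone_def intro: convex_convex_cone_hull)

lemma in_top_cone:
  assumes \<sigma>: "\<sigma> \<in> \<Sigma>"
  obtains \<alpha> where "\<alpha> \<in> cones N \<Sigma> (int d)" "\<sigma> face_of \<alpha>"
proof -
  have "finite {\<gamma> \<in> \<Sigma>. \<sigma> face_of \<gamma>}" "\<sigma> \<in> {\<gamma> \<in> \<Sigma>. \<sigma> face_of \<gamma>}"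
    using finite_fan \<sigma> convex_cone_in_fan by (auto intro: face_of_refl)
  from finite_has_maximal2[OF this] obtain \<alpha> where "\<alpha> \<in> {\<gamma> \<in> \<Sigma>. \<sigma> face_of \<gamma>}"
    and max: "\<forall>\<gamma>\<in>{\<gamma> \<in> \<Sigma>. \<sigma> face_of \<gamma>}. \<alpha> \<subseteq> \<gamma> \<longrightarrow> \<alpha> = \<gamma>"
    by (elim bexE conjE)
  then have \<alpha>: "\<alpha> \<in> \<Sigma>" "\<sigma> face_of \<alpha>" by simp_all
  have "cone_dim N \<alpha> = d"
  proof (rule maximal_dim[OF \<alpha>(1)])
    fix \<gamma> assume \<gamma>: "\<gamma> \<in> \<Sigma>" "\<alpha> face_of \<gamma>"
    then show "\<gamma> = \<alpha>"
      using max \<alpha>(2) face_of_trans[of \<sigma> \<alpha> \<gamma>] face_of_imp_subset[of \<alpha> \<gamma>] by auto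
  qed
  with \<alpha> that show ?thesis by (simp add: cones_def)
qed

lemma cone_dim_le:
  assumes "\<sigma> \<in> \<Sigma>"
  shows "cone_dim N \<sigma> \<le> d"
proof -
  obtain \<alpha> where \<alpha>: "\<alpha> \<in> cones N \<Sigma> (int d)" "\<sigma> face_of \<alpha>"
    using in_top_cone[OF assms] .
  have "cone_dim N \<sigma> \<le> cone_dim N \<alpha>"
    unfolding cone_dim_def by (rule dim_subset[OF cone_lattice_mono[OF face_of_imp_subset[OF \<alpha>(2)]]])
  with \<alpha>(1) show ?thesis by (simp add: cones_def)
qed

lemma cones_above_top: "cones N \<Sigma> (int d + 1) = {}"
  using cone_dim_le by (force simp: cones_def)

lemma compact_cones_simps:
  "compact_cones N \<Sigma> 0 = {{0}}" "compact_cones N \<Sigma> (- 1) = {}"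
proof -
  have "cone_dim N {0} = 0"
    by (simp add: cone_dim_def cone_lattice_def dim_eq_0)
  then show "compact_cones N \<Sigma> 0 = {{0}}"
    using rational_cone_dim_zero rational vertex_in_fan by (auto simp: compact_cones_def cones_def)
  show "compact_cones N \<Sigma> (- 1) = {}"
    by (auto simp: compact_cones_def cones_def)
qed

text \<open>
  The lattice of a cone is determined by its span, and a subspace of full dimension is everything.
  Hence the coefficient group of a top-dimensional cone involves only the lattice of that cone.
\<close>

lemma cone_lattice_above_top:
  assumes "\<alpha> \<in> cones N \<Sigma> (int d)" "\<gamma> \<in> \<Sigma>" "\<alpha> \<subseteq> \<gamma>"
  shows "cone_lattice N \<gamma> = cone_lattice N \<alpha>"
proof -
  have sub: "cone_lattice N \<alpha> \<subseteq> cone_lattice N \<gamma>"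
    by (rule cone_lattice_mono[OF assms(3)])
  have "dim (cone_lattice N \<gamma>) \<le> dim (cone_lattice N \<alpha>)"
    using assms cone_dim_le by (auto simp: cones_def cone_dim_def)
  then have "span (cone_lattice N \<alpha>) = span (cone_lattice N \<gamma>)"
    using sub by (intro dim_eq_span)
  moreover have "span (cone_lattice N \<alpha>) \<subseteq> span \<alpha>"
    by (rule span_minimal) (auto simp: cone_lattice_def)
  ultimately have "cone_lattice N \<gamma> \<subseteq> span \<alpha>"
    using span_superset by blast
  then have "cone_lattice N \<gamma> \<subseteq> cone_lattice N \<alpha>"
    by (auto simp: cone_lattice_def)
  with sub show ?thesis by blast
qed

section \<open>The coefficient groups of a fan\<close>

abbreviation "E \<equiv> ext_power N"

lemma wedge_cone_closed:
  "xs \<in> tuples (cone_lattice N \<gamma>) p \<Longrightarrow> wedge N xs \<in> carrier (E p)"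
  by (rule wedge_closed) (auto simp: tuples_def cone_lattice_def)

lemma subgroup_ext_power_sub: "subgroup (ext_power_sub N p (cone_lattice N \<gamma>)) (E p)"
proof -
  interpret E: comm_group "E p" by (rule comm_group_ext_power)
  show ?thesis
    unfolding ext_power_sub_def
    by (rule E.generate_is_subgroup) (auto intro: wedge_cone_closed)
qed

lemma subgroup_FZ: "subgroup (carrier (FZ N \<Sigma> p \<sigma>)) (E p)"
proof -
  interpret E: comm_group "E p" by (rule comm_group_ext_power)
  have "(\<Union>\<gamma>\<in>{\<gamma> \<in> \<Sigma>. \<sigma> face_of \<gamma>}. ext_power_sub N p (cone_lattice N \<gamma>)) \<subseteq> carrier (E p)"
    using subgroup.subset[OF subgroup_ext_power_sub] by blast
  from E.generate_is_subgroup[OF this] show ?thesis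
    by (simp add: FZ_def)
qed

lemma comm_group_FZ: "comm_group (FZ N \<Sigma> p \<sigma>)"
proof -
  interpret E: comm_group "E p" by (rule comm_group_ext_power)
  have "FZ N \<Sigma> p \<sigma> = (E p)\<lparr>carrier := carrier (FZ N \<Sigma> p \<sigma>)\<rparr>"
    by (simp add: FZ_def)
  moreover have "comm_group ((E p)\<lparr>carrier := carrier (FZ N \<Sigma> p \<sigma>)\<rparr>)"
    using group.group_comm_groupI[OF subgroup.subgroup_is_group[OF subgroup_FZ E.is_group]]
      subgroup.mem_carrier[OF subgroup_FZ] E.m_comm by simp
  ultimately show ?thesis by simp
qed

lemma mult_FZ: "monoid.mult (FZ N \<Sigma> p \<sigma>) = monoid.mult (E p)"
  by (simp add: FZ_def)

lemma wedge_in_FZ: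
  assumes "\<gamma> \<in> \<Sigma>" "\<sigma> face_of \<gamma>" "xs \<in> tuples (cone_lattice N \<gamma>) p"
  shows "wedge N xs \<in> carrier (FZ N \<Sigma> p \<sigma>)"
proof -
  have "wedge N xs \<in> ext_power_sub N p (cone_lattice N \<gamma>)"
    unfolding ext_power_sub_def using assms(3) by (intro generate.incl) auto
  then show ?thesis
    unfolding FZ_def using assms(1,2) by (auto intro!: generate.incl)
qed

lemma FZ_generated:
  assumes H: "subgroup H (E p)"
    and "\<And>\<gamma> xs. \<gamma> \<in> \<Sigma> \<Longrightarrow> \<sigma> face_of \<gamma> \<Longrightarrow> xs \<in> tuples (cone_lattice N \<gamma>) p \<Longrightarrow> wedge N xs \<in> H"
  shows "carrier (FZ N \<Sigma> p \<sigma>) \<subseteq> H"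
proof -
  interpret E: comm_group "E p" by (rule comm_group_ext_power)
  have "ext_power_sub N p (cone_lattice N \<gamma>) \<subseteq> H" if "\<gamma> \<in> \<Sigma>" "\<sigma> face_of \<gamma>" for \<gamma>
    unfolding ext_power_sub_def using that assms(2) by (intro E.generate_subgroup_incl H) auto
  then show ?thesis
    unfolding FZ_def by simp (intro E.generate_subgroup_incl H UN_least; simp)
qed

lemma FZ_top:
  assumes "\<alpha> \<in> cones N \<Sigma> (int d)"
  shows "carrier (FZ N \<Sigma> p \<alpha>) \<subseteq> ext_power_sub N p (cone_lattice N \<alpha>)"
proof (rule FZ_generated[OF subgroup_ext_power_sub])
  fix \<gamma> xs assume "\<gamma> \<in> \<Sigma>" "\<alpha> face_of \<gamma>" "xs \<in> tuples (cone_lattice N \<gamma>) p"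
  then have "xs \<in> tuples (cone_lattice N \<alpha>) p"
    using cone_lattice_above_top[OF assms] face_of_imp_subset by metis
  then show "wedge N xs \<in> ext_power_sub N p (cone_lattice N \<alpha>)"
    unfolding ext_power_sub_def by (intro generate.incl) auto
qed

lemma FZ_mono:
  assumes "\<tau> face_of \<sigma>"
  shows "carrier (FZ N \<Sigma> p \<sigma>) \<subseteq> carrier (FZ N \<Sigma> p \<tau>)"
  using assms by (intro FZ_generated subgroup_FZ) (metis wedge_in_FZ face_of_trans)

end

section \<open>Contraction with the volume element of a top-dimensional cone\<close>

lemma shuffle_determined_by_tail:
  assumes a: "a \<in> shuffle_perms p m" and b: "b \<in> shuffle_perms p m" and "p \<le> m"
    and tail: "\<And>i. i \<in> {p..<m} \<Longrightarrow> a i = b i"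
  shows "a = b"
proof -
  have perm: "a permutes {..<m}" "b permutes {..<m}"
    using a b by (simp_all add: shuffle_perms_def)
  have head: "{..<p} = {..<m} - {p..<m}" using \<open>p \<le> m\<close> by auto
  have image: "c ` {..<p} = {..<m} - c ` {p..<m}" if "c permutes {..<m}" for c
    unfolding head using that by (simp add: image_set_diff permutes_inj permutes_image)
  have "a ` {p..<m} = b ` {p..<m}"
    using tail by (intro image_cong) auto
  then have "a ` {..<p} = b ` {..<p}"
    by (simp add: image perm)
  moreover have "sorted (map c [0..<p]) \<and> distinct (map c [0..<p])" if "c \<in> shuffle_perms p m" for c
  proof -
    have "strict_mono_on {..<p} c" using that by (simp add: shuffle_perms_def)
    then have "sorted_wrt (<) (map c [0..<p])"
      by (auto simp: sorted_wrt_iff_nth_less intro: strict_mono_onD)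
    then show ?thesis by (simp only: strict_sorted_iff)
  qed
  ultimately have "map a [0..<p] = map b [0..<p]"
    using a b by (intro sorted_distinct_set_unique) (simp_all add: atLeast0LessThan)
  then have "a i = b i" if "i < p" for i
    using that by (simp add: map_eq_conv)
  moreover have "a i = b i" if "\<not> i < m" for i
    using that permutes_not_in[OF perm(1)] permutes_not_in[OF perm(2)] by simp
  ultimately show ?thesis
    using tail by (intro ext) (metis atLeastLessThan_iff not_less)
qed

lemma hom_finsum:
  assumes "abelian_group A" "abelian_group B" and h: "h \<in> hom (add_monoid A) (add_monoid B)"
    and "finite I" and f: "\<And>i. i \<in> I \<Longrightarrow> f i \<in> carrier A"
  shows "h (finsum A f I) = finsum B (\<lambda>i. h (f i)) I"
  using assms(4) f
proof (induction I)
  interpret A: abelian_group A by fact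
  interpret B: abelian_group B by fact
  interpret h: group_hom "add_monoid A" "add_monoid B" h
    by (intro group_hom.intro group_hom_axioms.intro A.a_group B.a_group h)
  {
    case empty
    show ?case using h.hom_one by simp
  next
    case (insert i I)
    have "h (f j) \<in> carrier B" if "j \<in> insert i I" for j
      using h.hom_closed insert.prems[OF that] by simp
    moreover have "finsum A f I \<in> carrier A"
      using insert.prems by (intro A.finsum_closed) auto
    ultimately show ?case
      using insert h.hom_mult[of "f i" "finsum A f I"] by (simp add: Pi_def)
  }
qed

lemma finite_shuffle_perms: "finite (shuffle_perms p m)"
  by (rule finite_subset[OF _ finite_permutations[of "{..<m}"]]) (auto simp: shuffle_perms_def)

locale fan_with_coefficients = fan N d \<Sigma> + cring R
  for N :: "'v::euclidean_space set" and d :: nat and \<Sigma> :: "'v set set"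
    and R :: "('r, 'm) ring_scheme" (structure)
begin

lemma extension_of_scalars_FZ: "extension_of_scalars R (FZ N \<Sigma> p \<sigma>)"
  by (intro extension_of_scalars.intro cring_axioms comm_group_FZ)

lemma abelian_group_FR: "abelian_group (FR N R \<Sigma> p \<sigma>)"
  unfolding FR_def by (rule extension_of_scalars.abelian_group_tensor[OF extension_of_scalars_FZ])

lemma wedge_R_closed:
  assumes "\<gamma> \<in> \<Sigma>" "\<sigma> face_of \<gamma>" "xs \<in> tuples (cone_lattice N \<gamma>) p"
  shows "wedge_R N R \<Sigma> \<sigma> xs \<in> carrier (FR N R \<Sigma> p \<sigma>)"
proof -
  have "length xs = p" using assms(3) by (simp add: tuples_def)
  then show ?thesis
    using extension_of_scalars.pure_tensor_closed[OF extension_of_scalars_FZ wedge_in_FZ[OF assms], of \<one>]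
    by (simp add: wedge_R_def FR_def)
qed

lemma F_dual_hom:
  assumes "u \<in> carrier (F_dual N R \<Sigma> p \<sigma>)"
  shows "u \<in> hom (add_monoid (FR N R \<Sigma> p \<sigma>)) (add_monoid R)"
    and "r \<in> carrier R \<Longrightarrow> X \<in> carrier (FR N R \<Sigma> p \<sigma>) \<Longrightarrow> u (r \<odot>\<^bsub>FR N R \<Sigma> p \<sigma>\<^esub> X) = r \<otimes> u X"
    and "u \<in> extensional (carrier (FR N R \<Sigma> p \<sigma>))"
  using assms by (auto simp: F_dual_def dual_module_def hom_def PiE_def)

lemma group_F_dual: "group (F_dual N R \<Sigma> p \<sigma>)"
proof -
  let ?T = "FR N R \<Sigma> p \<sigma>"
  interpret S: extension_of_scalars R "FZ N \<Sigma> p \<sigma>" by (rule extension_of_scalars_FZ)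
  have sc: "r \<odot>\<^bsub>?T\<^esub> X \<in> carrier ?T" if "r \<in> carrier R" "X \<in> carrier ?T" for r X
    using S.smult_closed that by (simp add: FR_def)
  interpret T: abelian_group ?T by (rule abelian_group_FR)
  show ?thesis
  proof (rule groupI)
    fix f assume "f \<in> carrier (F_dual N R \<Sigma> p \<sigma>)"
    then have "(\<lambda>X\<in>carrier ?T. \<ominus> f X) \<in> carrier (F_dual N R \<Sigma> p \<sigma>)"
      and "(\<lambda>X\<in>carrier ?T. \<ominus> f X) \<otimes>\<^bsub>F_dual N R \<Sigma> p \<sigma>\<^esub> f = \<one>\<^bsub>F_dual N R \<Sigma> p \<sigma>\<^esub>"
      by (auto simp: F_dual_def dual_module_def sc minus_add r_minus PiE_def Pi_def l_neg fun_eq_iff)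
    then show "\<exists>g\<in>carrier (F_dual N R \<Sigma> p \<sigma>). g \<otimes>\<^bsub>F_dual N R \<Sigma> p \<sigma>\<^esub> f = \<one>\<^bsub>F_dual N R \<Sigma> p \<sigma>\<^esub>"
      by blast
  qed (auto simp: F_dual_def dual_module_def sc a_ac r_distr PiE_def Pi_def extensional_def fun_eq_iff)
qed

lemma top_cone_simps:
  assumes \<alpha>: "\<alpha> \<in> cones N \<Sigma> (int d)"
  shows "\<alpha> \<in> \<Sigma>" "\<alpha> face_of \<alpha>" "lattice_basis (cone_lattice N \<alpha>) ys \<Longrightarrow> length ys = d"
  using \<alpha> convex_cone_in_fan lattice_basis_length[of "cone_lattice N \<alpha>" ys]
  by (auto simp: cones_def cone_dim_def intro: face_of_refl)

lemma shuffled_basis_tuples: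
  assumes \<alpha>: "\<alpha> \<in> cones N \<Sigma> (int d)" and ys: "lattice_basis (cone_lattice N \<alpha>) ys"
    and a: "a \<in> shuffle_perms p d" and "p \<le> d"
  shows "map (\<lambda>i. ys ! a i) [0..<p] \<in> tuples (cone_lattice N \<alpha>) p"
    and "map (\<lambda>i. ys ! a i) [p..<d] \<in> tuples (cone_lattice N \<alpha>) (d - p)"
proof -
  have "ys ! a i \<in> cone_lattice N \<alpha>" if "i < d" for i
  proof -
    have "a i < d"
      using a that permutes_in_image[of a "{..<d}" i] by (simp add: shuffle_perms_def)
    then show ?thesis
      unfolding lattice_basis_simps(3)[OF ys]
      by (intro int_span_base) (simp_all add: top_cone_simps(3)[OF \<alpha> ys])
  qed
  then show "map (\<lambda>i. ys ! a i) [0..<p] \<in> tuples (cone_lattice N \<alpha>) p"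
    and "map (\<lambda>i. ys ! a i) [p..<d] \<in> tuples (cone_lattice N \<alpha>) (d - p)"
    using \<open>p \<le> d\<close> by (auto simp: tuples_def)
qed

text \<open>
  The functional that reads off the coefficient of one of the wedge products of basis vectors that
  occur in a contraction. Each of them comes from the last \<open>d - p\<close> places of a shuffle, and a shuffle is
  determined by these, so distinct shuffles give distinct members of a basis.
\<close>

lemma coefficient_functional:
  assumes \<alpha>: "\<alpha> \<in> cones N \<Sigma> (int d)" and ys: "lattice_basis (cone_lattice N \<alpha>) ys"
    and "p \<le> d" and b: "b \<in> shuffle_perms p d"
  shows "\<exists>\<Phi>\<in>hom (add_monoid (FR N R \<Sigma> (d - p) \<alpha>)) (add_monoid R).
    (\<forall>r\<in>carrier R. \<forall>X\<in>carrier (FR N R \<Sigma> (d - p) \<alpha>). \<Phi> (r \<odot>\<^bsub>FR N R \<Sigma> (d - p) \<alpha>\<^esub> X) = r \<otimes> \<Phi> X) \<and>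
    (\<forall>a\<in>shuffle_perms p d. \<Phi> (wedge_R N R \<Sigma> \<alpha> (map (\<lambda>i. ys ! a i) [p..<d])) = (if a = b then \<one> else \<zero>))"
proof -
  note ys' = lattice_basis_simps[OF ys]
  note len = top_cone_simps(3)[OF \<alpha> ys]
  have tail: "strict_mono_on {..<d - p} (\<lambda>i. a (p + i))" "(\<lambda>i. a (p + i)) ` {..<d - p} \<subseteq> {..<d}"
    if a: "a \<in> shuffle_perms p d" for a
  proof -
    have m: "strict_mono_on {p..<d} a" and perm: "a permutes {..<d}"
      using a by (simp_all add: shuffle_perms_def)
    show "strict_mono_on {..<d - p} (\<lambda>i. a (p + i))"
      by (rule strict_mono_onI, rule strict_mono_onD[OF m]) auto
    show "(\<lambda>i. a (p + i)) ` {..<d - p} \<subseteq> {..<d}"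
    proof (rule image_subsetI)
      fix i assume "i \<in> {..<d - p}"
      then have "p + i < d" by simp
      then show "a (p + i) \<in> {..<d}" using permutes_in_image[OF perm, of "p + i"] by simp
    qed
  qed
  have "int_span (set ys) \<subseteq> N"
    unfolding ys'(3)[symmetric] by (auto simp: cone_lattice_def)
  from dual_functional[OF additive_subgroup_of_vectors_axioms ys'(1,2) this tail(1)[OF b]] tail(2)[OF b]
  obtain \<phi> where \<phi>: "\<phi> \<in> hom ((E (d - p))\<lparr>carrier := ext_power_sub N (d - p) (cone_lattice N \<alpha>)\<rparr>) integer_group"
    and \<phi>_wedge: "\<And>a. strict_mono_on {..<d - p} a \<Longrightarrow> a ` {..<d - p} \<subseteq> {..<d} \<Longrightarrow>
      \<phi> (wedge N (map (\<lambda>i. ys ! a i) [0..<d - p])) = (if \<forall>i<d - p. a i = b (p + i) then 1 else 0)"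
    by (auto simp: len ys'(3)[symmetric])
  have "\<phi> \<in> hom (FZ N \<Sigma> (d - p) \<alpha>) integer_group"
    using \<phi> FZ_top[OF \<alpha>, of "d - p"] by (simp add: hom_def mult_FZ subset_iff)
  from extension_of_scalars.extend_functional[OF extension_of_scalars_FZ this]
  obtain \<Phi> where \<Phi>: "\<Phi> \<in> hom (add_monoid (FR N R \<Sigma> (d - p) \<alpha>)) (add_monoid R)"
    and pure: "\<And>g r. g \<in> carrier (FZ N \<Sigma> (d - p) \<alpha>) \<Longrightarrow> r \<in> carrier R \<Longrightarrow>
      \<Phi> (pure_tensor R (FZ N \<Sigma> (d - p) \<alpha>) g r) = [\<phi> g] \<cdot> r"
    and scale: "\<forall>r\<in>carrier R. \<forall>X\<in>carrier (FR N R \<Sigma> (d - p) \<alpha>). \<Phi> (r \<odot>\<^bsub>FR N R \<Sigma> (d - p) \<alpha>\<^esub> X) = r \<otimes> \<Phi> X"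
    unfolding FR_def by blast
  have "\<Phi> (wedge_R N R \<Sigma> \<alpha> (map (\<lambda>i. ys ! a i) [p..<d])) = (if a = b then \<one> else \<zero>)"
    if a: "a \<in> shuffle_perms p d" for a
  proof -
    have map: "map (\<lambda>i. ys ! a i) [p..<d] = map (\<lambda>i. ys ! a (p + i)) [0..<d - p]"
      by (intro nth_equalityI) simp_all
    have "wedge N (map (\<lambda>i. ys ! a i) [p..<d]) \<in> carrier (FZ N \<Sigma> (d - p) \<alpha>)"
      by (rule wedge_in_FZ[OF top_cone_simps(1,2)[OF \<alpha>] shuffled_basis_tuples(2)[OF \<alpha> ys a \<open>p \<le> d\<close>]])
    then have "\<Phi> (wedge_R N R \<Sigma> \<alpha> (map (\<lambda>i. ys ! a i) [p..<d]))
        = [\<phi> (wedge N (map (\<lambda>i. ys ! a i) [p..<d]))] \<cdot> \<one>"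
      by (simp add: wedge_R_def pure)
    also have "\<phi> (wedge N (map (\<lambda>i. ys ! a i) [p..<d])) = (if \<forall>i<d - p. a (p + i) = b (p + i) then 1 else 0)"
      unfolding map by (rule \<phi>_wedge[OF tail[OF a]])
    also have "(\<forall>i<d - p. a (p + i) = b (p + i)) \<longleftrightarrow> a = b"
    proof
      assume *: "\<forall>i<d - p. a (p + i) = b (p + i)"
      show "a = b"
      proof (rule shuffle_determined_by_tail[OF a b \<open>p \<le> d\<close>])
        show "a i = b i" if "i \<in> {p..<d}" for i
        proof -
          have "i - p < d - p" "p + (i - p) = i" using that by auto
          with *[rule_format, of "i - p"] show ?thesis by simp
        qed
      qed
    qed simp
    also have "[((if a = b then 1 else 0) :: int)] \<cdot> \<one> = (if a = b then \<one> else \<zero>)"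
    proof -
      have "[(0::int)] \<cdot> \<one> = \<zero>" by (simp add: add_pow_def)
      then show ?thesis by simp
    qed
    finally show ?thesis .
  qed
  with \<Phi> scale show ?thesis by blast
qed

text \<open>
  Only the shuffle \<open>b\<close> contributes to the coefficient that \<open>\<Phi>\<close> reads off from the sum that defines the
  contraction. So the coefficients of a contraction are, up to sign, values of the functional \<open>u\<close>.
\<close>

lemma contraction:
  assumes \<alpha>: "\<alpha> \<in> cones N \<Sigma> (int d)" and ys: "lattice_basis (cone_lattice N \<alpha>) ys"
    and "p \<le> d"
    and x: "\<And>a. a \<in> shuffle_perms p d \<Longrightarrow> u (wedge_R N R \<Sigma> \<alpha> (map (\<lambda>i. ys ! a i) [0..<p])) \<in> carrier R"
  shows "contract N R \<Sigma> p \<alpha> u ys \<in> carrier (FR N R \<Sigma> (d - p) \<alpha>)"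
    and "\<lbrakk>b \<in> shuffle_perms p d; \<Phi> \<in> hom (add_monoid (FR N R \<Sigma> (d - p) \<alpha>)) (add_monoid R);
       \<forall>r\<in>carrier R. \<forall>X\<in>carrier (FR N R \<Sigma> (d - p) \<alpha>). \<Phi> (r \<odot>\<^bsub>FR N R \<Sigma> (d - p) \<alpha>\<^esub> X) = r \<otimes> \<Phi> X;
       \<forall>a\<in>shuffle_perms p d. \<Phi> (wedge_R N R \<Sigma> \<alpha> (map (\<lambda>i. ys ! a i) [p..<d])) = (if a = b then \<one> else \<zero>)\<rbrakk>
     \<Longrightarrow> \<Phi> (contract N R \<Sigma> p \<alpha> u ys)
       = [((-1::int) ^ (p * (p - 1) div 2))] \<cdot> ([sign b] \<cdot> u (wedge_R N R \<Sigma> \<alpha> (map (\<lambda>i. ys ! b i) [0..<p])))"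
proof -
  let ?T = "FR N R \<Sigma> (d - p) \<alpha>"
  interpret T: abelian_group ?T by (rule abelian_group_FR)
  note len = top_cone_simps(3)[OF \<alpha> ys]
  let ?x = "\<lambda>a. u (wedge_R N R \<Sigma> \<alpha> (map (\<lambda>i. ys ! a i) [0..<p]))"
  let ?y = "\<lambda>a. wedge_R N R \<Sigma> \<alpha> (map (\<lambda>i. ys ! a i) [p..<d])"
  have y: "?y a \<in> carrier ?T" if a: "a \<in> shuffle_perms p d" for a
    by (rule wedge_R_closed[OF top_cone_simps(1,2)[OF \<alpha>] shuffled_basis_tuples(2)[OF \<alpha> ys a \<open>p \<le> d\<close>]])
  have xy: "?x a \<odot>\<^bsub>?T\<^esub> ?y a \<in> carrier ?T" if a: "a \<in> shuffle_perms p d" for a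
    using extension_of_scalars.smult_closed[OF extension_of_scalars_FZ x[OF a], of "?y a"] y[OF a]
    by (simp add: FR_def)
  have summand: "[sign a] \<cdot>\<^bsub>?T\<^esub> (?x a \<odot>\<^bsub>?T\<^esub> ?y a) \<in> carrier ?T" if a: "a \<in> shuffle_perms p d" for a
    by (rule T.add.int_pow_closed[OF xy[OF a]])
  have contract: "contract N R \<Sigma> p \<alpha> u ys = [((-1::int) ^ (p * (p - 1) div 2))] \<cdot>\<^bsub>?T\<^esub>
      finsum ?T (\<lambda>a. [sign a] \<cdot>\<^bsub>?T\<^esub> (?x a \<odot>\<^bsub>?T\<^esub> ?y a)) (shuffle_perms p d)"
    by (simp add: contract_def Let_def len)
  have sum: "finsum ?T (\<lambda>a. [sign a] \<cdot>\<^bsub>?T\<^esub> (?x a \<odot>\<^bsub>?T\<^esub> ?y a)) (shuffle_perms p d) \<in> carrier ?T"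
    using summand by (intro T.finsum_closed) auto
  show "contract N R \<Sigma> p \<alpha> u ys \<in> carrier ?T"
    unfolding contract by (rule T.add.int_pow_closed[OF sum])
  assume b: "b \<in> shuffle_perms p d" and \<Phi>: "\<Phi> \<in> hom (add_monoid ?T) (add_monoid R)"
    and scale: "\<forall>r\<in>carrier R. \<forall>X\<in>carrier ?T. \<Phi> (r \<odot>\<^bsub>?T\<^esub> X) = r \<otimes> \<Phi> X"
    and coeff: "\<forall>a\<in>shuffle_perms p d. \<Phi> (?y a) = (if a = b then \<one> else \<zero>)"
  interpret F: group_hom "add_monoid ?T" "add_monoid R" \<Phi>
    by (intro group_hom.intro group_hom_axioms.intro T.a_group a_group \<Phi>)
  have pow: "\<Phi> ([k] \<cdot>\<^bsub>?T\<^esub> X) = [k] \<cdot> \<Phi> X" if "X \<in> carrier ?T" for k :: int and X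
    using F.hom_int_pow[of X k] that by (simp add: add_pow_def)
  have "\<Phi> (finsum ?T (\<lambda>a. [sign a] \<cdot>\<^bsub>?T\<^esub> (?x a \<odot>\<^bsub>?T\<^esub> ?y a)) (shuffle_perms p d))
      = (\<Oplus>a\<in>shuffle_perms p d. \<Phi> ([sign a] \<cdot>\<^bsub>?T\<^esub> (?x a \<odot>\<^bsub>?T\<^esub> ?y a)))"
    by (rule hom_finsum[OF abelian_group_FR abelian_group_axioms \<Phi> finite_shuffle_perms summand])
  also have "\<dots> = (\<Oplus>a\<in>shuffle_perms p d. if b = a then [sign a] \<cdot> ?x a else \<zero>)"
  proof (rule finsum_cong'[OF refl])
    show "\<Phi> ([sign a] \<cdot>\<^bsub>?T\<^esub> (?x a \<odot>\<^bsub>?T\<^esub> ?y a)) = (if b = a then [sign a] \<cdot> ?x a else \<zero>)"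
      if a: "a \<in> shuffle_perms p d" for a
      using scale x[OF a] y[OF a] coeff a by (simp add: pow[OF xy[OF a]])
  qed (use x in auto)
  also have "\<dots> = [sign b] \<cdot> ?x b"
    using x b by (intro add.finprod_singleton finite_shuffle_perms) auto
  finally show "\<Phi> (contract N R \<Sigma> p \<alpha> u ys) = [((-1::int) ^ (p * (p - 1) div 2))] \<cdot> ([sign b] \<cdot> ?x b)"
    unfolding contract pow[OF sum] by (rule arg_cong)
qed

lemma sign_multiple_cancel:
  fixes e e' :: int
  assumes "x \<in> carrier R" "y \<in> carrier R" and e: "e = 1 \<or> e = -1"
    and eq: "[e] \<cdot> x = [e] \<cdot> y"
  shows "x = y"
proof -
  have "[e] \<cdot> ([e] \<cdot> z) = z" if "z \<in> carrier R" for z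
    using that e add.int_pow_pow[OF that, of e e] by auto
  then show ?thesis using assms by metis
qed

text \<open>
  Comparing coefficients gives \<open>\<plusminus> c u(y) = \<plusminus> c u'(y)\<close> with equal signs for each wedge product \<open>y\<close> of basis
  vectors, and \<open>c\<close> cancels because it is not a zero-divisor.
\<close>

lemma contraction_cancel:
  assumes \<alpha>: "\<alpha> \<in> cones N \<Sigma> (int d)" and ys: "lattice_basis (cone_lattice N \<alpha>) ys"
    and "p \<le> d"
    and u: "\<And>a. a \<in> shuffle_perms p d \<Longrightarrow> u (wedge_R N R \<Sigma> \<alpha> (map (\<lambda>i. ys ! a i) [0..<p])) \<in> carrier R"
    and u': "\<And>a. a \<in> shuffle_perms p d \<Longrightarrow> u' (wedge_R N R \<Sigma> \<alpha> (map (\<lambda>i. ys ! a i) [0..<p])) \<in> carrier R"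
    and c: "c \<in> carrier R" "\<And>r. r \<in> carrier R \<Longrightarrow> c \<otimes> r = \<zero> \<Longrightarrow> r = \<zero>"
    and eq: "c \<odot>\<^bsub>FR N R \<Sigma> (d - p) \<alpha>\<^esub> contract N R \<Sigma> p \<alpha> u ys = c \<odot>\<^bsub>FR N R \<Sigma> (d - p) \<alpha>\<^esub> contract N R \<Sigma> p \<alpha> u' ys"
    and b: "b \<in> shuffle_perms p d"
  shows "u (wedge_R N R \<Sigma> \<alpha> (map (\<lambda>i. ys ! b i) [0..<p])) = u' (wedge_R N R \<Sigma> \<alpha> (map (\<lambda>i. ys ! b i) [0..<p]))"
proof -
  let ?z = "wedge_R N R \<Sigma> \<alpha> (map (\<lambda>i. ys ! b i) [0..<p])"
  let ?e = "(-1::int) ^ (p * (p - 1) div 2)"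
  obtain \<Phi> where \<Phi>: "\<Phi> \<in> hom (add_monoid (FR N R \<Sigma> (d - p) \<alpha>)) (add_monoid R)"
    and scale: "\<forall>r\<in>carrier R. \<forall>X\<in>carrier (FR N R \<Sigma> (d - p) \<alpha>). \<Phi> (r \<odot>\<^bsub>FR N R \<Sigma> (d - p) \<alpha>\<^esub> X) = r \<otimes> \<Phi> X"
    and coeff: "\<forall>a\<in>shuffle_perms p d. \<Phi> (wedge_R N R \<Sigma> \<alpha> (map (\<lambda>i. ys ! a i) [p..<d])) = (if a = b then \<one> else \<zero>)"
    using coefficient_functional[OF \<alpha> ys \<open>p \<le> d\<close> b] by blast
  define x where "x f = [?e] \<cdot> ([sign b] \<cdot> f ?z)" for f
  have x: "x u \<in> carrier R" "x u' \<in> carrier R"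
    unfolding x_def by (intro add.int_pow_closed u u' b)+
  have "c \<otimes> x f = \<Phi> (c \<odot>\<^bsub>FR N R \<Sigma> (d - p) \<alpha>\<^esub> contract N R \<Sigma> p \<alpha> f ys)"
    if f: "\<And>a. a \<in> shuffle_perms p d \<Longrightarrow> f (wedge_R N R \<Sigma> \<alpha> (map (\<lambda>i. ys ! a i) [0..<p])) \<in> carrier R" for f
  proof -
    have "contract N R \<Sigma> p \<alpha> f ys \<in> carrier (FR N R \<Sigma> (d - p) \<alpha>)"
      by (rule contraction(1)[OF \<alpha> ys \<open>p \<le> d\<close>]) (rule f)
    moreover have "\<Phi> (contract N R \<Sigma> p \<alpha> f ys) = x f"
      unfolding x_def by (rule contraction(2)[OF \<alpha> ys \<open>p \<le> d\<close> _ b \<Phi> scale coeff]) (rule f)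
    ultimately show ?thesis
      using scale c(1) by simp
  qed
  then have "c \<otimes> x u = c \<otimes> x u'"
    using eq u u' by metis
  then have "c \<otimes> (x u \<ominus> x u') = \<zero>"
    using x c(1) by (simp add: a_minus_def r_distr r_minus r_neg)
  then have "x u \<ominus> x u' = \<zero>"
    using c(2) x by simp
  then have "x u = x u'"
    using x minus_equality[of "x u" "\<ominus> x u'"] by (simp add: a_minus_def)
  moreover have "?e = 1 \<or> ?e = - 1"
    by (cases "even (p * (p - 1) div 2)") simp_all
  ultimately have "[sign b] \<cdot> u ?z = [sign b] \<cdot> u' ?z"
    unfolding x_def
    by (rule sign_multiple_cancel[OF add.int_pow_closed[OF u[OF b]] add.int_pow_closed[OF u'[OF b]], rotated])
  moreover have "sign b = 1 \<or> sign b = - 1"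
    by (simp add: sign_def)
  ultimately show ?thesis
    by (rule sign_multiple_cancel[OF u[OF b] u'[OF b], rotated])
qed

lemma F_incl_wedge_R:
  assumes "\<tau> face_of \<sigma>" "\<sigma> face_of \<gamma>" "\<gamma> \<in> \<Sigma>" "xs \<in> tuples (cone_lattice N \<gamma>) p"
  shows "F_incl N R \<Sigma> p \<sigma> \<tau> (wedge_R N R \<Sigma> \<sigma> xs) = wedge_R N R \<Sigma> \<tau> xs"
proof -
  have len: "length xs = p" using assms(4) by (simp add: tuples_def)
  have "tensor_map R (FZ N \<Sigma> p \<tau>) id (pure_tensor R (FZ N \<Sigma> p \<sigma>) (wedge N xs) \<one>)
      = pure_tensor R (FZ N \<Sigma> p \<tau>) (wedge N xs) \<one>"
    using wedge_in_FZ[OF assms(3,2,4)] FZ_mono[OF assms(1)]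
    by (intro tensor_map_id_pure_tensor extension_of_scalars_FZ) (simp_all add: mult_FZ)
  then show ?thesis
    using wedge_R_closed[OF assms(3,2,4)] by (simp add: F_incl_def wedge_R_def len)
qed


text \<open>
  A functional on \<open>F\<^sub>p(v) \<otimes> R\<close> is determined by its values on \<open>\<And>\<^sup>p L(\<alpha>)\<close> for the top-dimensional cones
  \<open>\<alpha>\<close>: the lattices of all cones generate \<open>F\<^sub>p(v)\<close>, and each of them is contained in such an \<open>L(\<alpha>)\<close>.
\<close>

lemma F_dual_vertex_eqI:
  assumes p: "p \<le> d"
    and u: "u \<in> carrier (F_dual N R \<Sigma> p {0})" "u' \<in> carrier (F_dual N R \<Sigma> p {0})"
    and ys: "\<And>\<alpha>. \<alpha> \<in> cones N \<Sigma> (int d) \<Longrightarrow> lattice_basis (cone_lattice N \<alpha>) (ys \<alpha>)"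
    and eq: "\<And>\<alpha> a. \<alpha> \<in> cones N \<Sigma> (int d) \<Longrightarrow> a \<in> shuffle_perms p d \<Longrightarrow>
      u (wedge_R N R \<Sigma> {0} (map (\<lambda>i. ys \<alpha> ! a i) [0..<p])) = u' (wedge_R N R \<Sigma> {0} (map (\<lambda>i. ys \<alpha> ! a i) [0..<p]))"
  shows "u = u'"
proof -
  let ?F = "FZ N \<Sigma> p {0}" and ?T = "FR N R \<Sigma> p {0}"
  interpret S: extension_of_scalars R ?F by (rule extension_of_scalars_FZ)
  interpret T: abelian_group ?T by (rule abelian_group_FR)
  interpret E: comm_group "E p" by (rule comm_group_ext_power)
  have hom1: "(\<lambda>g. f (pure_tensor R ?F g \<one>)) \<in> hom ?F (add_monoid R)"
    if f: "f \<in> carrier (F_dual N R \<Sigma> p {0})" for f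
  proof (rule homI)
    have cl: "pure_tensor R ?F g \<one> \<in> carrier ?T" if "g \<in> carrier ?F" for g
      using S.pure_tensor_closed[OF that one_closed] by (simp add: FR_def)
    show "f (pure_tensor R ?F g \<one>) \<in> carrier (add_monoid R)" if "g \<in> carrier ?F" for g
      using hom_in_carrier[OF F_dual_hom(1)[OF f]] cl[OF that] by simp
    show "f (pure_tensor R ?F (g \<otimes>\<^bsub>?F\<^esub> h) \<one>) = f (pure_tensor R ?F g \<one>) \<otimes>\<^bsub>add_monoid R\<^esub> f (pure_tensor R ?F h \<one>)"
      if "g \<in> carrier ?F" "h \<in> carrier ?F" for g h
      using S.pure_tensor_mult[OF that one_closed] hom_mult[OF F_dual_hom(1)[OF f]] cl that
      by (simp add: FR_def)
  qed
  let ?H = "{g \<in> carrier ?F. u (pure_tensor R ?F g \<one>) = u' (pure_tensor R ?F g \<one>)}"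
  have "subgroup ?H ?F"
    by (rule subgroup_equalizer[OF S.G.is_group a_group hom1[OF u(1)] hom1[OF u(2)]])
  then have "subgroup ?H ((E p)\<lparr>carrier := carrier ?F\<rparr>)"
    by (simp add: FZ_def)
  then have H: "subgroup ?H (E p)"
    by (rule E.incl_subgroup[OF subgroup_FZ])
  have "wedge N xs \<in> ?H" if \<gamma>: "\<gamma> \<in> \<Sigma>" and xs: "xs \<in> tuples (cone_lattice N \<gamma>) p" for \<gamma> xs
  proof -
    obtain \<alpha> where \<alpha>: "\<alpha> \<in> cones N \<Sigma> (int d)" "\<gamma> face_of \<alpha>"
      using in_top_cone[OF \<gamma>] .
    note bs = lattice_basis_simps[OF ys[OF \<alpha>(1)]]
    note top = top_cone_simps[OF \<alpha>(1)]
    show ?thesis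
    proof (rule wedge_int_span_in_subgroup[OF H bs(1)])
      show "set (ys \<alpha>) \<subseteq> N"
        using int_span_base[of "set (ys \<alpha>)"] bs(3) by (auto simp: cone_lattice_def)
      show "xs \<in> tuples (int_span (set (ys \<alpha>))) p"
        using xs cone_lattice_mono[OF face_of_imp_subset[OF \<alpha>(2)], of N] bs(3)
        by (auto simp: tuples_def)
      fix a assume "a \<in> shuffle_perms p (length (ys \<alpha>))"
      then have a: "a \<in> shuffle_perms p d"
        using top(3)[OF ys[OF \<alpha>(1)]] by simp
      show "wedge N (map (\<lambda>i. ys \<alpha> ! a i) [0..<p]) \<in> ?H"
        using eq[OF \<alpha>(1) a]
          wedge_in_FZ[OF top(1) vertex_face[OF top(1)] shuffled_basis_tuples(1)[OF \<alpha>(1) ys[OF \<alpha>(1)] a p]]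
        by (simp add: wedge_R_def)
    qed
  qed
  then have FH: "carrier ?F \<subseteq> ?H"
    by (intro FZ_generated[OF H])
  have "carrier (tensor R ?F) \<subseteq> {X \<in> carrier (add_monoid ?T). u X = u' X}"
  proof (rule S.tensor_generated)
    show "subgroup {X \<in> carrier (add_monoid ?T). u X = u' X} (add_monoid (tensor R ?F))"
      unfolding FR_def[symmetric]
      by (rule subgroup_equalizer[OF T.a_group a_group F_dual_hom(1)[OF u(1)] F_dual_hom(1)[OF u(2)]])
    fix g r assume g: "g \<in> carrier ?F" and r: "r \<in> carrier R"
    have cl: "pure_tensor R ?F g s \<in> carrier ?T" if "s \<in> carrier R" for s
      using S.pure_tensor_closed[OF g that] by (simp add: FR_def)
    have "pure_tensor R ?F g r = r \<odot>\<^bsub>?T\<^esub> pure_tensor R ?F g \<one>"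
      using S.smult_pure_tensor[OF r g one_closed] r by (simp add: FR_def)
    then have "u (pure_tensor R ?F g r) = u' (pure_tensor R ?F g r)"
      using F_dual_hom(2)[OF u(1) r cl[OF one_closed]] F_dual_hom(2)[OF u(2) r cl[OF one_closed]] FH g
      by auto
    with cl[OF r] show "pure_tensor R ?F g r \<in> {X \<in> carrier (add_monoid ?T). u X = u' X}"
      by simp
  qed
  then have "u X = u' X" if "X \<in> carrier ?T" for X
    using that by (auto simp: FR_def)
  then show "u = u'"
    using F_dual_hom(3)[OF u(1)] F_dual_hom(3)[OF u(2)] by (intro extensionalityI)
qed

section \<open>The cap product on classes\<close>

lemma group_cochains: "group (cochains N R \<Sigma> p q)"
  unfolding cochains_def by (intro sum_group group_F_dual)

lemma group_BM_chains: "group (BM_chains N R \<Sigma> p q)"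
  unfolding BM_chains_def by (intro sum_group abelian_group.a_group abelian_group_FR)

lemma cochain_vertex:
  assumes "c \<in> carrier (cochains N R \<Sigma> p 0)"
  shows "c {0} \<in> carrier (F_dual N R \<Sigma> p {0})" "c \<in> extensional {{0}}"
  using assms by (auto simp: cochains_def carrier_sum_group group_F_dual compact_cones_simps PiE_def)

text \<open>
  There are no cones of dimension \<open>-1\<close>, and none of dimension \<open>d + 1\<close>. So cohomology classes of degree \<open>0\<close>
  and homology classes of degree \<open>d\<close> are singletons, and the cap product is the map on chains.
\<close>

lemma coboundaries_trivial: "coboundaries N R \<Sigma> ori p 0 = {\<one>\<^bsub>cochains N R \<Sigma> p 0\<^esub>}"
proof -
  have "coboundary N R \<Sigma> ori p (- 1) c = \<one>\<^bsub>cochains N R \<Sigma> p 0\<^esub>" for c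
    by (simp add: coboundary_def cochains_def compact_cones_simps finprod_def foldD_empty
        monoid.one_closed[OF group.is_monoid[OF group_F_dual]])
  then show ?thesis
    using group.is_monoid[OF group_cochains, THEN monoid.one_closed]
    by (auto simp: coboundaries_def)
qed

lemma BM_boundaries_trivial: "BM_boundaries N R \<Sigma> ori p (int d) = {\<one>\<^bsub>BM_chains N R \<Sigma> p (int d)\<^esub>}"
proof -
  have "BM_boundary N R \<Sigma> ori p (int d + 1) c = \<one>\<^bsub>BM_chains N R \<Sigma> p (int d)\<^esub>" for c
    by (simp add: BM_boundary_def BM_chains_def cones_above_top
        abelian_monoid.finsum_empty[OF abelian_group.axioms(1)[OF abelian_group_FR]] cong: restrict_cong)
  then show ?thesis
    using group.is_monoid[OF group_BM_chains, THEN monoid.one_closed]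
    by (auto simp: BM_boundaries_def)
qed

lemma cohomology_singleton:
  assumes "X \<in> carrier (cohomology N R \<Sigma> ori p 0)"
  obtains c where "X = {c}" "c \<in> carrier (cochains N R \<Sigma> p 0)"
proof -
  obtain c where X: "X = coboundaries N R \<Sigma> ori p 0 #>\<^bsub>cocycles N R \<Sigma> ori p 0\<^esub> c"
    and "c \<in> carrier (cocycles N R \<Sigma> ori p 0)"
    using assms by (auto simp: cohomology_def carrier_FactGroup)
  then have c: "c \<in> carrier (cochains N R \<Sigma> p 0)"
    by (simp add: cocycles_def kernel_def)
  have "X = {c}"
    unfolding X coboundaries_trivial
    using monoid.l_one[OF group.is_monoid[OF group_cochains] c]
    by (simp add: r_coset_def cocycles_def)
  with c that show ?thesis by blast
qed

lemma cap_product_singleton: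
  assumes "cap_chain N R \<Sigma> ori d w p c \<in> carrier (BM_chains N R \<Sigma> (d - p) (int d))"
  shows "cap_product N R \<Sigma> ori d w p {c} = {cap_chain N R \<Sigma> ori d w p c}"
  unfolding cap_product_def induced_map_def BM_boundaries_trivial
  using monoid.l_one[OF group.is_monoid[OF group_BM_chains] assms]
  by (simp add: r_coset_def BM_cycles_def)

lemma F_restr_wedge_R:
  assumes \<alpha>: "\<alpha> \<in> cones N \<Sigma> (int d)" and ys: "lattice_basis (cone_lattice N \<alpha>) ys"
    and a: "a \<in> shuffle_perms p d" and p: "p \<le> d"
  shows "F_restr N R \<Sigma> p {0} \<alpha> u (wedge_R N R \<Sigma> \<alpha> (map (\<lambda>i. ys ! a i) [0..<p]))
    = u (wedge_R N R \<Sigma> {0} (map (\<lambda>i. ys ! a i) [0..<p]))"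
proof -
  note top = top_cone_simps(1,2)[OF \<alpha>]
  note t = shuffled_basis_tuples(1)[OF \<alpha> ys a p]
  show ?thesis
    by (simp add: F_restr_def wedge_R_closed[OF top t] F_incl_wedge_R[OF vertex_face[OF top(1)] top(2,1) t])
qed

text \<open>
  On wedge products of vectors of \<open>\<alpha>\<close>, the restriction of a functional to \<open>\<alpha>\<close> has the values of the
  functional itself. So cancelling in the cap chain at every \<open>\<alpha>\<close> gives the values that determine it.
\<close>

lemma cap_chain_injective:
  assumes ori: "fan_orientation N \<Sigma> ori" and w: "weight_function N R \<Sigma> d w" and p: "p \<le> d"
    and c: "c \<in> carrier (cochains N R \<Sigma> p 0)"
  shows "cap_chain N R \<Sigma> ori d w p c \<in> carrier (BM_chains N R \<Sigma> (d - p) (int d))"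
    and "c' \<in> carrier (cochains N R \<Sigma> p 0) \<Longrightarrow>
      cap_chain N R \<Sigma> ori d w p c = cap_chain N R \<Sigma> ori d w p c' \<Longrightarrow> c = c'"
proof -
  have ys: "lattice_basis (cone_lattice N \<alpha>) (ori \<alpha>)" if "\<alpha> \<in> cones N \<Sigma> (int d)" for \<alpha>
    using ori that by (auto simp: fan_orientation_def cones_def)
  have w': "w \<alpha> \<in> carrier R" "\<And>r. r \<in> carrier R \<Longrightarrow> w \<alpha> \<otimes> r = \<zero> \<Longrightarrow> r = \<zero>"
    if "\<alpha> \<in> cones N \<Sigma> (int d)" for \<alpha>
    using w that by (auto simp: weight_function_def)
  have val: "F_restr N R \<Sigma> p {0} \<alpha> (e {0}) (wedge_R N R \<Sigma> \<alpha> (map (\<lambda>i. ori \<alpha> ! a i) [0..<p])) \<in> carrier R"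
    if e: "e \<in> carrier (cochains N R \<Sigma> p 0)" and \<alpha>: "\<alpha> \<in> cones N \<Sigma> (int d)"
      and a: "a \<in> shuffle_perms p d" for e \<alpha> a
  proof -
    note top = top_cone_simps(1,2)[OF \<alpha>]
    have "wedge_R N R \<Sigma> {0} (map (\<lambda>i. ori \<alpha> ! a i) [0..<p]) \<in> carrier (FR N R \<Sigma> p {0})"
      by (rule wedge_R_closed[OF top(1) vertex_face[OF top(1)] shuffled_basis_tuples(1)[OF \<alpha> ys[OF \<alpha>] a p]])
    then show ?thesis
      using hom_in_carrier[OF F_dual_hom(1)[OF cochain_vertex(1)[OF e]]]
      by (simp add: F_restr_wedge_R[OF \<alpha> ys[OF \<alpha>] a p])
  qed
  have finite: "finite (cones N \<Sigma> (int d))"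
    using finite_fan by (simp add: cones_def)
  have "w \<alpha> \<odot>\<^bsub>FR N R \<Sigma> (d - p) \<alpha>\<^esub> contract N R \<Sigma> p \<alpha> (F_restr N R \<Sigma> p {0} \<alpha> (c {0})) (ori \<alpha>)
      \<in> carrier (FR N R \<Sigma> (d - p) \<alpha>)" if \<alpha>: "\<alpha> \<in> cones N \<Sigma> (int d)" for \<alpha>
    unfolding FR_def
    by (intro extension_of_scalars.smult_closed extension_of_scalars_FZ w'(1)[OF \<alpha>]
        contraction(1)[OF \<alpha> ys[OF \<alpha>] p, unfolded FR_def] val[OF c \<alpha>])
  then show "cap_chain N R \<Sigma> ori d w p c \<in> carrier (BM_chains N R \<Sigma> (d - p) (int d))"
    using finite
    by (auto simp: BM_chains_def carrier_sum_group abelian_group.a_group[OF abelian_group_FR] cap_chain_def)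
  assume c': "c' \<in> carrier (cochains N R \<Sigma> p 0)"
    and eq: "cap_chain N R \<Sigma> ori d w p c = cap_chain N R \<Sigma> ori d w p c'"
  have "c {0} = c' {0}"
  proof (rule F_dual_vertex_eqI[OF p cochain_vertex(1)[OF c] cochain_vertex(1)[OF c'] ys])
    fix \<alpha> a assume \<alpha>: "\<alpha> \<in> cones N \<Sigma> (int d)" and a: "a \<in> shuffle_perms p d"
    have "w \<alpha> \<odot>\<^bsub>FR N R \<Sigma> (d - p) \<alpha>\<^esub> contract N R \<Sigma> p \<alpha> (F_restr N R \<Sigma> p {0} \<alpha> (c {0})) (ori \<alpha>)
        = w \<alpha> \<odot>\<^bsub>FR N R \<Sigma> (d - p) \<alpha>\<^esub> contract N R \<Sigma> p \<alpha> (F_restr N R \<Sigma> p {0} \<alpha> (c' {0})) (ori \<alpha>)"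
      using fun_cong[OF eq, of \<alpha>] \<alpha> by (simp add: cap_chain_def)
    then have "F_restr N R \<Sigma> p {0} \<alpha> (c {0}) (wedge_R N R \<Sigma> \<alpha> (map (\<lambda>i. ori \<alpha> ! a i) [0..<p]))
        = F_restr N R \<Sigma> p {0} \<alpha> (c' {0}) (wedge_R N R \<Sigma> \<alpha> (map (\<lambda>i. ori \<alpha> ! a i) [0..<p]))"
      by (rule contraction_cancel[OF \<alpha> ys[OF \<alpha>] p _ _ w'(1)[OF \<alpha>] _ _ a, rotated -1])
        (rule val[OF c \<alpha>] val[OF c' \<alpha>] w'(2)[OF \<alpha>]; assumption)+
    then show "c {0} (wedge_R N R \<Sigma> {0} (map (\<lambda>i. ori \<alpha> ! a i) [0..<p]))
        = c' {0} (wedge_R N R \<Sigma> {0} (map (\<lambda>i. ori \<alpha> ! a i) [0..<p]))"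
      by (simp add: F_restr_wedge_R[OF \<alpha> ys[OF \<alpha>] a p])
  qed
  then show "c = c'"
    by (intro extensionalityI[OF cochain_vertex(2)[OF c] cochain_vertex(2)[OF c']]) simp
qed

end

theorem proposition3p23:
  fixes N :: "'v::euclidean_space set"
    and R :: "('r, 'm) ring_scheme"
    and \<Sigma> :: "'v set set"
    and ori :: "'v set \<Rightarrow> 'v list"
    and w :: "'v set \<Rightarrow> 'r"
    and d p :: nat
  assumes "cring R"
    and "is_lattice N"
    and "pure_fan N d \<Sigma>"
    and "fan_orientation N \<Sigma> ori"
    and "balanced N R \<Sigma> ori d w"
    and "p \<le> d"
  shows "inj_on (cap_product N R \<Sigma> ori d w p) (carrier (cohomology N R \<Sigma> ori p 0))"
proof (rule inj_onI)
  interpret fan_with_coefficients N d \<Sigma> R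
    using assms by (intro fan_with_coefficients.intro fan.intro)
  have w: "weight_function N R \<Sigma> d w"
    using assms(5) by (simp add: balanced_def)
  note cap = cap_chain_injective[OF assms(4) w assms(6)]
  fix X Y
  assume "X \<in> carrier (cohomology N R \<Sigma> ori p 0)" "Y \<in> carrier (cohomology N R \<Sigma> ori p 0)"
  then obtain b c where X: "X = {b}" "b \<in> carrier (cochains N R \<Sigma> p 0)"
    and Y: "Y = {c}" "c \<in> carrier (cochains N R \<Sigma> p 0)"
    by (metis cohomology_singleton)
  assume "cap_product N R \<Sigma> ori d w p X = cap_product N R \<Sigma> ori d w p Y"
  then have "cap_chain N R \<Sigma> ori d w p b = cap_chain N R \<Sigma> ori d w p c"
    unfolding X(1) Y(1)
    by (simp add: cap_product_singleton[OF cap(1)[OF X(2)]] cap_product_singleton[OF cap(1)[OF Y(2)]])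
  then show "X = Y"
    using cap(2)[OF X(2) Y(2)] X(1) Y(1) by simp
qed

end
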